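(* Let $k$ be an uncountable, algebraically closed field, let $G$ be a projective algebraic group over $k$, and let $\Gamma$ be a smooth projective curve over $k$. Let $\Gamma(e)$ be the $\Gamma$-equivalence class of the identity $e$ of $G$, and let $\theta: G\to G/\Gamma(e)$, $g\mapsto [g]$, be the natural quotient homomorphism (on $k$-points). Then $\theta^{-1}([e])$ is a countable union of translates of an abelian subvariety of $G$; that is, there exist an abelian subvariety $A_0\subset G$ and a countable family $(x_i)_{i\in I}$ of $k$-points of $G$ such that $\theta^{-1}([e])=\bigcup_{i\in I}(x_i+A_0)$.
   Context: The group law of $G$ is written additively and $e$ denotes the identity element. Points, subsets and unions are at the level of $k$-points. "Countable" includes finite. A smooth projective curve is assumed irreducible. $\Gamma$-equivalence: two $k$-points $a,b$ of $G$ are $\Gamma$-equivalent if they are connected by a finite chain of rational maps from $\Gamma$, i.e. there are $k$-points $a=g_0,g_1,\dots,g_n=b$ of $G$ such that for each $1\le j\le n$ there are a rational map $f_j:\Gamma\to G$ (which is automatically a morphism, since $\Gamma$ is a smooth curve and $G$ is projective) and two $k$-points $0_j,\infty_j$ of $\Gamma$ with $f_j(0_j)=g_{j-1}$ and $f_j(\infty_j)=g_j$. The set $\Gamma(e)$ of $k$-points $\Gamma$-equivalent to $e$ is a subgroup of $G$, and $G/\Gamma(e)$ (also denoted $G/\Gamma$) is a group. $[g]$ denotes the class of $g$ in $G/\Gamma(e)$. *)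

theory Defs
  imports
    "HOL-Library.Poly_Mapping"
    "HOL-Library.Function_Algebras"
    "HOL-Library.Extended_Nat"
    "HOL-Library.Countable_Set"
    "HOL-Computational_Algebra.Polynomial"
    "HOL-Algebra.Coset"
begin

text \<open>
  Projective varieties over an algebraically closed field are treated classically: a variety is
  the set of its \<open>k\<close>-points, as a Zariski closed subset of some \<open>P^n\<close> with the induced reduced
  structure. Closed sets are not assumed irreducible.
\<close>

section \<open>Polynomials in several variables\<close>

type_synonym ('v, 'k) mvpoly = "('v \<Rightarrow>\<^sub>0 nat) \<Rightarrow>\<^sub>0 'k"

definition eval :: "('v, 'k::field) mvpoly \<Rightarrow> ('v \<Rightarrow> 'k) \<Rightarrow> 'k" where
  "eval p v =
     (\<Sum>m\<in>Poly_Mapping.keys p. Poly_Mapping.lookup p m *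
        (\<Prod>i\<in>Poly_Mapping.keys m. v i ^ Poly_Mapping.lookup m i))"

definition partial_deriv :: "'v \<Rightarrow> ('v, 'k::field) mvpoly \<Rightarrow> ('v, 'k) mvpoly" where
  "partial_deriv i p =
     (\<Sum>m\<in>Poly_Mapping.keys p. Poly_Mapping.single (m - Poly_Mapping.single i 1)
                                    (of_nat (Poly_Mapping.lookup m i) * Poly_Mapping.lookup p m))"

text \<open>Forms of degree \<open>d\<close> in \<open>x_0, ..., x_n\<close>; the zero polynomial is a form of every degree.\<close>

definition form :: "nat \<Rightarrow> nat \<Rightarrow> (nat, 'k::field) mvpoly \<Rightarrow> bool" where
  "form n d p \<longleftrightarrow>
     (\<forall>m\<in>Poly_Mapping.keys p. Poly_Mapping.keys m \<subseteq> {..n} \<and>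
        (\<Sum>i\<le>n. Poly_Mapping.lookup m i) = d)"

text \<open>
  Bihomogeneous forms of bidegree \<open>(d, d')\<close> in \<open>x_0, ..., x_n\<close> and \<open>y_0, ..., y_{n'}\<close>, where
  \<open>x_i\<close> is the variable \<open>Inl i\<close> and \<open>y_j\<close> the variable \<open>Inr j\<close>.
\<close>

definition biform ::
  "nat \<Rightarrow> nat \<Rightarrow> nat \<Rightarrow> nat \<Rightarrow> (nat + nat, 'k::field) mvpoly \<Rightarrow> bool" where
  "biform n n' d d' p \<longleftrightarrow>
     (\<forall>m\<in>Poly_Mapping.keys p. Poly_Mapping.keys m \<subseteq> Inl ` {..n} \<union> Inr ` {..n'} \<and>
        (\<Sum>i\<le>n. Poly_Mapping.lookup m (Inl i)) = d \<and>
        (\<Sum>j\<le>n'. Poly_Mapping.lookup m (Inr j)) = d')"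

section \<open>Projective space and its closed subsets\<close>

text \<open>A point is the set of all its homogeneous coordinate vectors.\<close>

type_synonym 'k point = "(nat \<Rightarrow> 'k) set"

definition coord_space :: "nat \<Rightarrow> (nat \<Rightarrow> 'k::field) set" where
  "coord_space n = {v. \<forall>i>n. v i = 0}"

definition point_of :: "(nat \<Rightarrow> 'k::field) \<Rightarrow> 'k point" where
  "point_of v = {\<lambda>i. c * v i |c. c \<noteq> 0}"

definition proj_space :: "nat \<Rightarrow> 'k::field point set" where
  "proj_space n = point_of ` (coord_space n - {\<lambda>_. 0})"

definition zero_locus :: "nat \<Rightarrow> (nat, 'k::field) mvpoly set \<Rightarrow> 'k point set" where
  "zero_locus n S = {x \<in> proj_space n. \<forall>p\<in>S. \<forall>v\<in>x. eval p v = 0}"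

definition proj_closed :: "nat \<Rightarrow> 'k::field point set \<Rightarrow> bool" where
  "proj_closed n X \<longleftrightarrow> (\<exists>S. (\<forall>p\<in>S. \<exists>d. form n d p) \<and> X = zero_locus n S)"

definition proj_irreducible :: "nat \<Rightarrow> 'k::field point set \<Rightarrow> bool" where
  "proj_irreducible n X \<longleftrightarrow>
     X \<noteq> {} \<and>
     (\<forall>A B. proj_closed n A \<longrightarrow> proj_closed n B \<longrightarrow> X \<subseteq> A \<union> B \<longrightarrow> X \<subseteq> A \<or> X \<subseteq> B)"

definition krull_dim :: "nat \<Rightarrow> 'k::field point set \<Rightarrow> enat" where
  "krull_dim n X =
     Sup {enat d |d. \<exists>Z. (\<forall>i\<le>d. proj_closed n (Z i) \<and> proj_irreducible n (Z i) \<and> Z i \<subseteq> X) \<and>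
                       (\<forall>i<d. Z i \<subset> Z (Suc i))}"

section \<open>Smoothness and curves\<close>

text \<open>
  The tangent space to the affine cone over \<open>X\<close> at the coordinate vector \<open>v\<close>, i.e. the kernel of
  the Jacobian matrix of the homogeneous ideal of \<open>X\<close>. By Euler's relation it contains \<open>v\<close>, and
  its quotient by the line through \<open>v\<close> is (up to a twist) the Zariski tangent space of \<open>X\<close> at the
  point \<open>v\<close>; this accounts for the \<open>+ 1\<close> in the definition of smoothness.
\<close>

definition cone_tangent :: "nat \<Rightarrow> 'k::field point set \<Rightarrow> (nat \<Rightarrow> 'k) \<Rightarrow> (nat \<Rightarrow> 'k) set" where
  "cone_tangent n X v =
     {w \<in> coord_space n.
        \<forall>p d. form n d p \<longrightarrow> (\<forall>x\<in>X. \<forall>u\<in>x. eval p u = 0) \<longrightarrow>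
          (\<Sum>i\<le>n. eval (partial_deriv i p) v * w i) = 0}"

definition smooth :: "nat \<Rightarrow> 'k::field point set \<Rightarrow> bool" where
  "smooth n X \<longleftrightarrow>
     (\<forall>x\<in>X. \<forall>v\<in>x.
        enat (vector_space.dim (\<lambda>c w i. c * w i) (cone_tangent n X v)) = krull_dim n X + 1)"

lemma vector_space_coords: "vector_space (\<lambda>(c::'k::field) (w::nat \<Rightarrow> 'k) i. c * w i)"
  by unfold_locales (auto simp: fun_eq_iff algebra_simps)

definition smooth_projective_curve :: "nat \<Rightarrow> 'k::field point set \<Rightarrow> bool" where
  "smooth_projective_curve n X \<longleftrightarrow>
     proj_closed n X \<and> proj_irreducible n X \<and> krull_dim n X = 1 \<and> smooth n X"

section \<open>Morphisms and rational maps\<close>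

text \<open>
  \<open>X \<subseteq> P^n\<close> is locally closed in the applications. A morphism is given, near each point, by forms
  of one common degree without common zero.
\<close>

definition morphism ::
  "nat \<Rightarrow> 'k::field point set \<Rightarrow> nat \<Rightarrow> 'k point set \<Rightarrow> ('k point \<Rightarrow> 'k point) \<Rightarrow> bool" where
  "morphism n X m Y f \<longleftrightarrow>
     f ` X \<subseteq> Y \<and>
     (\<forall>x\<in>X. \<exists>d F.
        (\<forall>j\<le>m. form n d (F j)) \<and>
        (\<forall>v\<in>x. \<exists>j\<le>m. eval (F j) v \<noteq> 0) \<and>
        (\<forall>y\<in>X. \<forall>v\<in>y. (\<exists>j\<le>m. eval (F j) v \<noteq> 0) \<longrightarrow>
           f y = point_of (\<lambda>j. if j \<le> m then eval (F j) v else 0)))"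

text \<open>Morphisms from a product \<open>X \<times> X' \<subseteq> P^n \<times> P^{n'}\<close>, via bihomogeneous forms.\<close>

definition morphism2 ::
  "nat \<Rightarrow> 'k::field point set \<Rightarrow> nat \<Rightarrow> 'k point set \<Rightarrow> nat \<Rightarrow> 'k point set \<Rightarrow>
     ('k point \<Rightarrow> 'k point \<Rightarrow> 'k point) \<Rightarrow> bool" where
  "morphism2 n X n' X' m Y f \<longleftrightarrow>
     (\<forall>x\<in>X. \<forall>x'\<in>X'. f x x' \<in> Y) \<and>
     (\<forall>x\<in>X. \<forall>x'\<in>X'. \<exists>d d' F.
        (\<forall>j\<le>m. biform n n' d d' (F j)) \<and>
        (\<forall>v\<in>x. \<forall>v'\<in>x'. \<exists>j\<le>m. eval (F j) (case_sum v v') \<noteq> 0) \<and>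
        (\<forall>y\<in>X. \<forall>y'\<in>X'. \<forall>v\<in>y. \<forall>v'\<in>y'. (\<exists>j\<le>m. eval (F j) (case_sum v v') \<noteq> 0) \<longrightarrow>
           f y y' = point_of (\<lambda>j. if j \<le> m then eval (F j) (case_sum v v') else 0)))"

text \<open>
  A rational map from the irreducible closed set \<open>X\<close> to \<open>Y\<close>, represented by a morphism \<open>f\<close> on a
  nonempty open subset \<open>U\<close> of \<open>X\<close>.
\<close>

definition rational_map ::
  "nat \<Rightarrow> 'k::field point set \<Rightarrow> nat \<Rightarrow> 'k point set \<Rightarrow> 'k point set \<Rightarrow>
     ('k point \<Rightarrow> 'k point) \<Rightarrow> bool" where
  "rational_map n X m Y U f \<longleftrightarrow>
     U \<noteq> {} \<and> (\<exists>C. proj_closed n C \<and> U = X - C) \<and> morphism n U m Y f"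

section \<open>Projective algebraic groups\<close>

text \<open>
  Commutativity is not assumed (a disconnected projective group need not be commutative), hence
  the multiplicative notation of \<^theory>\<open>HOL-Algebra.Group\<close>.
\<close>

definition projective_algebraic_group :: "nat \<Rightarrow> 'k::field point monoid \<Rightarrow> bool" where
  "projective_algebraic_group n G \<longleftrightarrow>
     group G \<and> proj_closed n (carrier G) \<and>
     morphism2 n (carrier G) n (carrier G) n (carrier G) (\<lambda>x y. x \<otimes>\<^bsub>G\<^esub> y) \<and>
     morphism n (carrier G) n (carrier G) (\<lambda>x. inv\<^bsub>G\<^esub> x)"

text \<open>
  An abelian variety is an irreducible complete algebraic group; its commutativity is a theorem
  (rigidity), not part of the definition. Closed subsets of \<open>G\<close> are complete, and the group law
  of \<open>G\<close> restricts to a morphism.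
\<close>

definition abelian_subvariety :: "nat \<Rightarrow> 'k::field point monoid \<Rightarrow> 'k point set \<Rightarrow> bool" where
  "abelian_subvariety n G A \<longleftrightarrow> subgroup A G \<and> proj_closed n A \<and> proj_irreducible n A"

section \<open>Gamma-equivalence\<close>

text \<open>
  One link of a chain. When \<open>\<Gamma>\<close> is a smooth curve and \<open>G\<close> is projective, every rational map is
  represented on \<open>U = \<Gamma>\<close>, so requiring the two points to lie in \<open>U\<close> is no restriction.
\<close>

definition gamma_link ::
  "nat \<Rightarrow> 'k::field point set \<Rightarrow> nat \<Rightarrow> 'k point monoid \<Rightarrow> 'k point \<Rightarrow> 'k point \<Rightarrow> bool" where
  "gamma_link m \<Gamma> n G a b \<longleftrightarrow>
     (\<exists>U f p q. rational_map m \<Gamma> n (carrier G) U f \<and> p \<in> U \<and> q \<in> U \<and> f p = a \<and> f q = b)"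

definition gamma_equiv ::
  "nat \<Rightarrow> 'k::field point set \<Rightarrow> nat \<Rightarrow> 'k point monoid \<Rightarrow> 'k point \<Rightarrow> 'k point \<Rightarrow> bool" where
  "gamma_equiv m \<Gamma> n G a b \<longleftrightarrow>
     (\<exists>N g. (\<forall>j\<le>N. g j \<in> carrier G) \<and> g 0 = a \<and> g N = b \<and>
            (\<forall>j<N. gamma_link m \<Gamma> n G (g j) (g (Suc j))))"

definition gamma_class ::
  "nat \<Rightarrow> 'k::field point set \<Rightarrow> nat \<Rightarrow> 'k point monoid \<Rightarrow> 'k point \<Rightarrow> 'k point set" where
  "gamma_class m \<Gamma> n G a = {b \<in> carrier G. gamma_equiv m \<Gamma> n G a b}"

text \<open>
  The quotient map to \<open>G Mod gamma_class m \<Gamma> n G \<one>\<close>. The class of the identity is a normal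
  subgroup, so left and right cosets agree.
\<close>

definition gamma_quot ::
  "nat \<Rightarrow> 'k::field point set \<Rightarrow> nat \<Rightarrow> 'k point monoid \<Rightarrow> 'k point \<Rightarrow> 'k point set" where
  "gamma_quot m \<Gamma> n G g = gamma_class m \<Gamma> n G \<one>\<^bsub>G\<^esub> #>\<^bsub>G\<^esub> g"

end

theory Submission
  imports Defs
begin

text \<open>
  The class of the identity is itself an abelian subvariety, so a single translate suffices. The
  reason is the classical fact that a subgroup generated by irreducible constructible sets through
  the identity is closed and irreducible.

  Right translation maps links to links, so the class \<open>H\<close> of the identity is a subgroup. If a
  chain from the identity passes from \<open>g\<close> to \<open>g'\<close> along a rational map \<open>f\<close> defined on \<open>U \<subseteq> \<Gamma>\<close>, then
  \<open>f ` U\<close> lies in \<open>H\<close>, and its translate by the inverse of \<open>g\<close> passes through the identity and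
  through the quotient of \<open>g'\<close> by \<open>g\<close>. Multiplying such sets along the chain shows that every element
  of \<open>H\<close> lies, together with the identity, in the image in \<open>H\<close> of an irreducible variety
  (\<open>gamma_class_swept_out\<close>).

  Such images are called parametrized below. Three facts about them give the result.
  The closures of parametrized sets are irreducible, and chains of irreducible closed sets in
  projective space have bounded length (\<open>irreducible_chain_bound\<close>), so there is a parametrized set
  \<open>P \<subseteq> H\<close> through the identity whose closure \<open>A\<close> is maximal. Products of parametrized sets are
  parametrized (\<open>parametrized_morphism2_image\<close>), so maximality makes \<open>A\<close> stable under multiplication
  by \<open>H\<close>; as translations and inversion are homeomorphisms, \<open>A\<close> is a group that contains \<open>H\<close>.
  Finally \<open>P\<close> contains a nonempty open subset \<open>V\<close> of \<open>A\<close> (\<open>parametrized_contains_open\<close>, a weak form of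
  Chevalley's theorem), and \<open>A\<close> consists of products of two elements of \<open>V\<close> because \<open>A\<close> is
  irreducible. Hence \<open>A \<subseteq> H\<close>, so \<open>H = A\<close> is closed and irreducible.

  Both geometric inputs are proved by elementary means. The bound on chains compares the number of
  monomials in functions that separate successive members of a chain with the number of monomials in the
  coordinates. The weak form of Chevalley's theorem eliminates one variable at a time by
  pseudo-division.
\<close>

section \<open>Polynomial functions\<close>

text \<open>
  Projections are handled by restricting the variables to a set \<open>J\<close>, so that all functions live on
  the same space of vectors.
\<close>

inductive polyfun :: "'v set \<Rightarrow> (('v \<Rightarrow> 'k::field) \<Rightarrow> 'k) \<Rightarrow> bool" for J where
  const: "polyfun J (\<lambda>_. c)"
| var: "i \<in> J \<Longrightarrow> polyfun J (\<lambda>u. u i)"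
| add: "polyfun J f \<Longrightarrow> polyfun J g \<Longrightarrow> polyfun J (\<lambda>u. f u + g u)"
| mult: "polyfun J f \<Longrightarrow> polyfun J g \<Longrightarrow> polyfun J (\<lambda>u. f u * g u)"

lemma polyfun_diff:
  assumes "polyfun J f" "polyfun J g"
  shows "polyfun J (\<lambda>u. f u - g u)"
proof -
  have "polyfun J (\<lambda>u. f u + (-1) * g u)"
    by (intro polyfun.intros assms)
  thus ?thesis by simp
qed

lemma polyfun_sum: "(\<And>a. a \<in> A \<Longrightarrow> polyfun J (f a)) \<Longrightarrow> polyfun J (\<lambda>u. \<Sum>a\<in>A. f a u)"
  by (induction A rule: infinite_finite_induct) (auto intro: polyfun.intros)

lemma polyfun_prod: "(\<And>a. a \<in> A \<Longrightarrow> polyfun J (f a)) \<Longrightarrow> polyfun J (\<lambda>u. \<Prod>a\<in>A. f a u)"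
  by (induction A rule: infinite_finite_induct) (auto intro: polyfun.intros)

lemma polyfun_power: "polyfun J f \<Longrightarrow> polyfun J (\<lambda>u. f u ^ e)"
  by (induction e) (auto intro: polyfun.intros)

lemma polyfun_subst:
  assumes "polyfun J p" "\<And>i. i \<in> J \<Longrightarrow> polyfun K (\<lambda>u. s u i)"
  shows "polyfun K (\<lambda>u. p (s u))"
  using assms by induction (auto intro: polyfun.intros)

lemma polyfun_mono: "polyfun I p \<Longrightarrow> I \<subseteq> J \<Longrightarrow> polyfun J p"
  using polyfun_subst[of I p J "\<lambda>u. u"] by (auto intro: polyfun.intros)

lemma polyfun_cong: "polyfun J p \<Longrightarrow> (\<And>i. i \<in> J \<Longrightarrow> u i = u' i) \<Longrightarrow> p u = p u'"
  by (induction rule: polyfun.induct) auto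

lemma polyfun_eval:
  assumes "\<And>i. i \<in> V \<Longrightarrow> polyfun J (\<lambda>u. s u i)" "\<And>m. m \<in> Poly_Mapping.keys p \<Longrightarrow> Poly_Mapping.keys m \<subseteq> V"
  shows "polyfun J (\<lambda>u. eval p (s u))"
  unfolding eval_def
  by (intro polyfun_sum polyfun.mult polyfun.const polyfun_prod polyfun_power) (use assms in blast)

section \<open>Evaluation of polynomials and forms\<close>

lemma eval_over_superset:
  assumes "finite M" "Poly_Mapping.keys p \<subseteq> M"
  shows "eval p v = (\<Sum>m\<in>M. Poly_Mapping.lookup p m * (\<Prod>i\<in>Poly_Mapping.keys m. v i ^ Poly_Mapping.lookup m i))"
  unfolding eval_def using assms by (intro sum.mono_neutral_left) (auto simp: in_keys_iff)

lemma eval_zero [simp]: "eval 0 v = 0"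
  by (simp add: eval_def)

lemma eval_add: "eval (p + q) v = eval p v + eval q v"
proof -
  let ?M = "Poly_Mapping.keys p \<union> Poly_Mapping.keys q"
  have "Poly_Mapping.keys (p + q) \<subseteq> ?M" by (rule keys_add)
  thus ?thesis
    by (simp add: eval_over_superset[of ?M] lookup_add algebra_simps sum.distrib)
qed

lemma eval_single: "eval (Poly_Mapping.single m a) v = a * (\<Prod>i\<in>Poly_Mapping.keys m. v i ^ Poly_Mapping.lookup m i)"
  by (subst eval_over_superset[of "{m}"]) auto

lemma prod_keys_over_superset:
  assumes "finite V" "Poly_Mapping.keys m \<subseteq> V"
  shows "(\<Prod>i\<in>Poly_Mapping.keys m. (v i :: 'k::field) ^ Poly_Mapping.lookup m i) = (\<Prod>i\<in>V. v i ^ Poly_Mapping.lookup m i)"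
  using assms by (intro prod.mono_neutral_left) (auto simp: in_keys_iff)

lemma eval_single_mult: "eval (Poly_Mapping.single m a * Poly_Mapping.single m' b) v = eval (Poly_Mapping.single m a) v * eval (Poly_Mapping.single m' b) v"
proof -
  let ?V = "Poly_Mapping.keys m \<union> Poly_Mapping.keys m'"
  have "Poly_Mapping.keys (m + m') \<subseteq> ?V" by (rule keys_add)
  thus ?thesis
    using prod_keys_over_superset[of ?V "m + m'" v] prod_keys_over_superset[of ?V m v]
      prod_keys_over_superset[of ?V m' v]
    by (simp add: mult_single eval_single lookup_add power_add prod.distrib)
qed

lemma mvpoly_induct [case_names zero add single]:
  fixes p :: "('v, 'k::field) mvpoly"
  assumes "P 0" "\<And>p q. P p \<Longrightarrow> P q \<Longrightarrow> P (p + q)" "\<And>m a. P (Poly_Mapping.single m a)"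
  shows "P p"
proof (induction p rule: update_induct)
  case const show ?case by (rule assms)
next
  case (update f a b)
  have "Poly_Mapping.update a b f = f + Poly_Mapping.single a b"
    using update.hyps
    by (intro poly_mapping_eqI) (auto simp: lookup_update lookup_add lookup_single when_def in_keys_iff)
  thus ?case using assms(2)[OF update.IH assms(3)] by simp
qed

lemma eval_mult: "eval (p * q) v = eval p v * eval q v"
proof (induction p rule: mvpoly_induct)
  case (single m a)
  show ?case
    by (induction q rule: mvpoly_induct) (simp_all add: eval_add eval_single_mult algebra_simps)
qed (simp_all add: eval_add algebra_simps)

lemma form_add: "form n d p \<Longrightarrow> form n d q \<Longrightarrow> form n d (p + q)"
  unfolding form_def using keys_add[of p q] by blast

lemma form_mult:
  assumes "form n d p" "form n e q"
  shows "form n (d + e) (p * q)"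
  unfolding form_def
proof
  fix m assume "m \<in> Poly_Mapping.keys (p * q)"
  then obtain a b where ab: "m = a + b" "a \<in> Poly_Mapping.keys p" "b \<in> Poly_Mapping.keys q"
    using keys_mult[of p q] by blast
  moreover have "Poly_Mapping.keys (a + b) \<subseteq> Poly_Mapping.keys a \<union> Poly_Mapping.keys b" by (rule keys_add)
  ultimately show "Poly_Mapping.keys m \<subseteq> {..n} \<and> (\<Sum>i\<le>n. Poly_Mapping.lookup m i) = d + e"
    using assms unfolding form_def by (auto simp: lookup_add sum.distrib)
qed

text \<open>
  Working with the functions that forms induce, rather than with the forms themselves, makes
  substitution a matter of composing functions.
\<close>

definition formfun :: "nat \<Rightarrow> nat \<Rightarrow> ((nat \<Rightarrow> 'k::field) \<Rightarrow> 'k) \<Rightarrow> bool" where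
  "formfun n d f \<longleftrightarrow> (\<exists>p. form n d p \<and> f = eval p)"

lemma formfunI: "form n d p \<Longrightarrow> formfun n d (eval p)"
  by (auto simp: formfun_def)

lemma formfun_zero: "formfun n d (\<lambda>_. 0)"
  unfolding formfun_def by (rule exI[of _ 0]) (auto simp: form_def)

lemma formfun_const: "formfun n 0 (\<lambda>_. c)"
  unfolding formfun_def by (rule exI[of _ "Poly_Mapping.single 0 c"]) (auto simp: form_def eval_single)

lemma formfun_var:
  assumes "i \<le> n" shows "formfun n 1 (\<lambda>v. v i)"
proof -
  have "(\<Sum>j\<le>n. Poly_Mapping.lookup (Poly_Mapping.single i (1::nat)) j) = 1"
    using assms by (simp add: lookup_single when_def)
  thus ?thesis
    unfolding formfun_def using assms
    by (intro exI[of _ "Poly_Mapping.single (Poly_Mapping.single i 1) 1"]) (auto simp: form_def eval_single)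
qed

lemma formfun_add: "formfun n d f \<Longrightarrow> formfun n d g \<Longrightarrow> formfun n d (\<lambda>v. f v + g v)"
  unfolding formfun_def using form_add by (force simp: eval_add)

lemma formfun_mult: "formfun n d f \<Longrightarrow> formfun n e g \<Longrightarrow> formfun n (d + e) (\<lambda>v. f v * g v)"
  unfolding formfun_def using form_mult by (force simp: eval_mult)

lemma formfun_sum: "(\<And>a. a \<in> A \<Longrightarrow> formfun n d (f a)) \<Longrightarrow> formfun n d (\<lambda>v. \<Sum>a\<in>A. f a v)"
  by (induction A rule: infinite_finite_induct) (auto intro: formfun_zero formfun_add)

lemma formfun_prod:
  "finite A \<Longrightarrow> (\<And>a. a \<in> A \<Longrightarrow> formfun n (d a) (f a)) \<Longrightarrow>
     formfun n (\<Sum>a\<in>A. d a) (\<lambda>v. \<Prod>a\<in>A. f a v)"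
  by (induction A rule: finite_induct) (auto intro: formfun_const formfun_mult)

lemma formfun_power: "formfun n d f \<Longrightarrow> formfun n (d * e) (\<lambda>v. f v ^ e)"
  by (induction e) (auto intro: formfun_const formfun_mult)

lemma formfun_polyfun: "formfun n d f \<Longrightarrow> polyfun {..n} f"
  unfolding formfun_def form_def by (auto intro!: polyfun_eval[of "{..n}" "{..n}" "\<lambda>u. u"] polyfun.var)

lemma formfun_scale:
  assumes "formfun n d f"
  shows "f (\<lambda>i. c * v i) = c ^ d * f v"
proof -
  obtain p where p: "form n d p" "f = eval p" using assms unfolding formfun_def by blast
  have "Poly_Mapping.lookup p m * (\<Prod>i\<in>Poly_Mapping.keys m. (c * v i) ^ Poly_Mapping.lookup m i)
      = c ^ d * (Poly_Mapping.lookup p m * (\<Prod>i\<in>Poly_Mapping.keys m. v i ^ Poly_Mapping.lookup m i))" if "m \<in> Poly_Mapping.keys p" for m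
  proof -
    have m: "Poly_Mapping.keys m \<subseteq> {..n}" "(\<Sum>i\<le>n. Poly_Mapping.lookup m i) = d" using p that by (auto simp: form_def)
    show ?thesis
      unfolding prod_keys_over_superset[OF finite_atMost m(1)] power_mult_distrib prod.distrib
      by (simp add: m(2) flip: power_sum)
  qed
  thus ?thesis unfolding p(2) eval_def sum_distrib_left by (rule sum.cong[OF refl])
qed

text \<open>
  The coefficients of \<open>c \<mapsto> f (c v)\<close> are the homogeneous components of \<open>f\<close>. Collecting them in a
  univariate polynomial avoids any bookkeeping of degrees and convolutions.
\<close>

lemma polyfun_homogeneous_components:
  assumes "polyfun {..n} f"
  obtains P :: "(nat \<Rightarrow> 'k::field) \<Rightarrow> 'k poly"
  where "\<And>c v. f (\<lambda>i. c * v i) = poly (P v) c" "\<And>d. formfun n d (\<lambda>v. coeff (P v) d)"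
proof -
  have "\<exists>P :: (nat \<Rightarrow> 'k) \<Rightarrow> 'k poly.
      (\<forall>c v. f (\<lambda>i. c * v i) = poly (P v) c) \<and> (\<forall>d. formfun n d (\<lambda>v. coeff (P v) d))"
    using assms
  proof induction
    case (const c)
    show ?case
    proof (intro exI[of _ "\<lambda>_. [:c:]"] conjI allI)
      show "formfun n d (\<lambda>v. coeff [:c:] d)" for d
        by (cases d) (auto intro: formfun_const formfun_zero)
    qed auto
  next
    case (var i)
    show ?case
    proof (intro exI[of _ "\<lambda>v. monom (v i) 1"] conjI allI)
      show "formfun n d (\<lambda>v. coeff (monom (v i) 1) d)" for d
        using var by (cases "d = 1") (auto intro: formfun_var[simplified] formfun_zero)
    qed (auto simp: poly_monom)
  next
    case (add f g)
    then obtain P Q where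
      "\<And>c v. f (\<lambda>i. c * v i) = poly (P v) c" "\<And>d. formfun n d (\<lambda>v. coeff (P v) d)"
      "\<And>c v. g (\<lambda>i. c * v i) = poly (Q v) c" "\<And>d. formfun n d (\<lambda>v. coeff (Q v) d)" by blast
    thus ?case by (intro exI[of _ "\<lambda>v. P v + Q v"]) (auto intro: formfun_add)
  next
    case (mult f g)
    then obtain P Q where *:
      "\<And>c v. f (\<lambda>i. c * v i) = poly (P v) c" "\<And>d. formfun n d (\<lambda>v. coeff (P v) d)"
      "\<And>c v. g (\<lambda>i. c * v i) = poly (Q v) c" "\<And>d. formfun n d (\<lambda>v. coeff (Q v) d)" by blast
    have "formfun n d (\<lambda>v. coeff (P v * Q v) d)" for d
      unfolding coeff_mult
    proof (rule formfun_sum)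
      fix i assume "i \<in> {..d}"
      thus "formfun n d (\<lambda>v. coeff (P v) i * coeff (Q v) (d - i))"
        using formfun_mult[OF *(2)[of i] *(4)[of "d - i"]] by simp
    qed
    with * show ?case by (intro exI[of _ "\<lambda>v. P v * Q v"]) auto
  qed
  thus thesis using that by blast
qed

lemma infinite_alg_closed: "infinite (UNIV :: 'k::alg_closed_field set)"
proof
  assume fin: "finite (UNIV :: 'k set)"
  define p where "p = (\<Prod>a\<in>(UNIV :: 'k set). [:-a, 1:])"
  have "degree p = (\<Sum>a\<in>(UNIV :: 'k set). degree [:-a, 1:])"
    unfolding p_def by (rule degree_prod_eq_sum_degree) simp
  hence "degree p = card (UNIV :: 'k set)" by simp
  hence "degree p > 0" using fin by (simp add: card_gt_0_iff)
  moreover from this have "degree (p + 1) = degree p" by (intro degree_add_eq_left) simp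
  ultimately obtain x where x: "poly (p + 1) x = 0"
    using alg_closed_imp_poly_has_root[of "p + 1"] by auto
  have "poly p x = (\<Prod>a\<in>(UNIV :: 'k set). x - a)" by (simp add: p_def poly_prod)
  also have "\<dots> = 0" using fin by (intro prod_zero) auto
  finally show False using x by simp
qed

lemma poly_nonzero_value:
  fixes p :: "'k::alg_closed_field poly"
  assumes "p \<noteq> 0" shows "\<exists>c. c \<noteq> 0 \<and> poly p c \<noteq> 0"
proof -
  have "finite (insert 0 {x. poly p x = 0})" using poly_roots_finite[OF assms] by simp
  from ex_new_if_finite[OF infinite_alg_closed this] show ?thesis by auto
qed

section \<open>Eliminating variables\<close>

text \<open>
  The restrictions to \<open>Z\<close> of the polynomial functions in the variables \<open>J\<close> form an integral domain.
\<close>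

definition irred_on :: "'v set \<Rightarrow> ('v \<Rightarrow> 'k::field) set \<Rightarrow> bool" where
  "irred_on J Z \<longleftrightarrow> Z \<noteq> {} \<and>
     (\<forall>p q. polyfun J p \<longrightarrow> polyfun J q \<longrightarrow> (\<exists>z\<in>Z. p z \<noteq> 0) \<longrightarrow> (\<exists>z\<in>Z. q z \<noteq> 0) \<longrightarrow>
        (\<exists>z\<in>Z. p z \<noteq> 0 \<and> q z \<noteq> 0))"

text \<open>
  If only the variables in \<open>J\<close> are allowed, the closure is that of the projection of \<open>Z\<close> to the
  coordinates in \<open>J\<close>, and the values of \<open>w\<close> outside \<open>J\<close> are irrelevant.
\<close>

definition in_closure :: "'v set \<Rightarrow> ('v \<Rightarrow> 'k::field) set \<Rightarrow> ('v \<Rightarrow> 'k) \<Rightarrow> bool" where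
  "in_closure J Z w \<longleftrightarrow> (\<forall>p. polyfun J p \<longrightarrow> (\<forall>z\<in>Z. p z = 0) \<longrightarrow> p w = 0)"

lemma irred_onD:
  assumes "irred_on J Z" "polyfun J p" "polyfun J q" "\<exists>z\<in>Z. p z \<noteq> 0" "\<exists>z\<in>Z. q z \<noteq> 0"
  shows "\<exists>z\<in>Z. p z \<noteq> 0 \<and> q z \<noteq> 0"
  using assms unfolding irred_on_def by blast

lemma irred_on_mono:
  assumes "irred_on J Z" "I \<subseteq> J" shows "irred_on I Z"
  unfolding irred_on_def
proof (intro conjI allI impI)
  show "Z \<noteq> {}" using assms(1) by (simp add: irred_on_def)
  fix p q assume "polyfun I p" "polyfun I q" "\<exists>z\<in>Z. p z \<noteq> 0" "\<exists>z\<in>Z. q z \<noteq> 0"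
  thus "\<exists>z\<in>Z. p z \<noteq> 0 \<and> q z \<noteq> 0"
    by (intro irred_onD[OF assms(1)] polyfun_mono[OF _ assms(2)])
qed

lemma in_closure_image:
  assumes w: "in_closure K S w" and \<pi>: "\<And>z. z \<in> S \<Longrightarrow> \<pi> z \<in> T" "\<And>i. i \<in> J \<Longrightarrow> polyfun K (\<lambda>z. \<pi> z i)"
  shows "in_closure J T (\<pi> w)"
  unfolding in_closure_def
proof (intro allI impI)
  fix p assume p: "polyfun J p" "\<forall>z\<in>T. p z = 0"
  have "polyfun K (\<lambda>z. p (\<pi> z))" by (rule polyfun_subst[OF p(1) \<pi>(2)])
  moreover have "\<forall>z\<in>S. p (\<pi> z) = 0" using p(2) \<pi>(1) by simp
  ultimately show "p (\<pi> w) = 0" 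
    using spec[OF w[unfolded in_closure_def], of "\<lambda>z. p (\<pi> z)"] by simp
qed

text \<open>
  Polynomials in one further variable whose coefficients are polynomial functions in \<open>I\<close>. The degree
  bound has to be uniform in \<open>w\<close>, because the degree of an individual \<open>F w\<close> drops where leading
  coefficients vanish.
\<close>

definition polyfam :: "'v set \<Rightarrow> (('v \<Rightarrow> 'k::field) \<Rightarrow> 'k poly) \<Rightarrow> bool" where
  "polyfam I F \<longleftrightarrow> (\<forall>i. polyfun I (\<lambda>w. coeff (F w) i)) \<and> (\<exists>D. \<forall>w. degree (F w) \<le> D)"

lemma polyfam_coeff: "polyfam I F \<Longrightarrow> polyfun I (\<lambda>w. coeff (F w) i)"
  by (simp add: polyfam_def)

lemma polyfam_const: "polyfun I c \<Longrightarrow> polyfam I (\<lambda>w. [:c w:])"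
  unfolding polyfam_def
proof (intro conjI allI exI[of _ 0])
  fix i assume "polyfun I c"
  thus "polyfun I (\<lambda>w. coeff [:c w:] i)" by (cases i) (auto intro: polyfun.const)
qed auto

lemma polyfam_monom: "polyfun I c \<Longrightarrow> polyfam I (\<lambda>w. monom (c w) e)"
  unfolding polyfam_def
proof (intro conjI allI exI[of _ e])
  fix i assume "polyfun I c"
  thus "polyfun I (\<lambda>w. coeff (monom (c w) e) i)" by (cases "i = e") (auto intro: polyfun.const)
qed (simp add: degree_monom_le)

lemma polyfam_add:
  assumes "polyfam I F" "polyfam I G" shows "polyfam I (\<lambda>w. F w + G w)"
proof -
  obtain D E where "\<And>w. degree (F w) \<le> D" "\<And>w. degree (G w) \<le> E"
    using assms unfolding polyfam_def by blast
  hence "degree (F w + G w) \<le> max D E" for w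
    by (meson degree_add_le max.coboundedI1 max.coboundedI2)
  with assms show ?thesis unfolding polyfam_def by (auto intro: polyfun.add)
qed

lemma polyfam_mult:
  assumes "polyfam I F" "polyfam I G" shows "polyfam I (\<lambda>w. F w * G w)"
proof -
  obtain D E where "\<And>w. degree (F w) \<le> D" "\<And>w. degree (G w) \<le> E"
    using assms unfolding polyfam_def by blast
  hence "degree (F w * G w) \<le> D + E" for w
    by (meson add_mono degree_mult_le order_trans)
  moreover have "polyfun I (\<lambda>w. coeff (F w * G w) i)" for i
    unfolding coeff_mult by (intro polyfun_sum polyfun.mult polyfam_coeff assms)
  ultimately show ?thesis unfolding polyfam_def by blast
qed

lemma polyfam_diff:
  assumes "polyfam I F" "polyfam I G" shows "polyfam I (\<lambda>w. F w - G w)"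
proof -
  have "polyfam I (\<lambda>w. F w + [:-1:] * G w)"
    by (intro polyfam_add polyfam_mult polyfam_const polyfun.const assms)
  thus ?thesis by simp
qed

lemma polyfam_power: "polyfam I F \<Longrightarrow> polyfam I (\<lambda>w. F w ^ e)"
proof (induction e)
  case 0
  have "polyfam I (\<lambda>w. [:1:])" by (intro polyfam_const polyfun.const)
  thus ?case by (simp add: one_pCons)
qed (auto intro: polyfam_mult)

lemma polyfam_cutoff:
  assumes "polyfam I F" shows "polyfam I (\<lambda>w. poly_cutoff e (F w))"
proof -
  have "polyfun I (\<lambda>w. coeff (poly_cutoff e (F w)) i)" for i
    using polyfam_coeff[OF assms, of i]
    by (cases "i < e") (auto simp: coeff_poly_cutoff intro: polyfun.const)
  moreover have "degree (poly_cutoff e (F w)) \<le> e" for w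
    by (rule degree_le) (simp add: coeff_poly_cutoff)
  ultimately show ?thesis unfolding polyfam_def by blast
qed

lemma polyfun_as_polyfam:
  assumes "polyfun (insert j I) p" "j \<notin> I"
  obtains F where "polyfam I F" "\<And>w t. p (w(j := t)) = poly (F w) t"
proof -
  have "\<exists>F. polyfam I F \<and> (\<forall>w t. p (w(j := t)) = poly (F w) t)"
    using assms(1)
  proof induction
    case (const c)
    show ?case by (intro exI[of _ "\<lambda>_. [:c:]"]) (auto intro: polyfam_const polyfun.const)
  next
    case (var i)
    show ?case
    proof (cases "i = j")
      case True
      thus ?thesis
        by (intro exI[of _ "\<lambda>_. monom 1 1"]) (auto intro: polyfam_monom polyfun.const simp: poly_monom)
    next
      case False
      thus ?thesis using var
        by (intro exI[of _ "\<lambda>w. [:w i:]"]) (auto intro: polyfam_const polyfun.var)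
    qed
  next
    case (add f g)
    then obtain F G where *: "polyfam I F" "\<And>w t. f (w(j := t)) = poly (F w) t"
      "polyfam I G" "\<And>w t. g (w(j := t)) = poly (G w) t" by blast
    show ?case
      by (intro exI[of _ "\<lambda>w. F w + G w"] conjI allI polyfam_add *(1,3)) (simp only: * poly_add)
  next
    case (mult f g)
    then obtain F G where *: "polyfam I F" "\<And>w t. f (w(j := t)) = poly (F w) t"
      "polyfam I G" "\<And>w t. g (w(j := t)) = poly (G w) t" by blast
    show ?case
      by (intro exI[of _ "\<lambda>w. F w * G w"] conjI allI polyfam_mult *(1,3)) (simp only: * poly_mult)
  qed
  thus thesis using that by blast
qed

lemma polyfam_pseudo_division:
  assumes G: "polyfam I G" "\<And>w. degree (G w) \<le> d" and d: "d > 0" and F: "polyfam I F"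
  obtains s Q R where "polyfam I Q" "polyfam I R" "\<And>w. degree (R w) < d"
    "\<And>w. smult (coeff (G w) d ^ s) (F w) = Q w * G w + R w"
proof -
  obtain e where "\<And>w. degree (F w) < e"
    using F unfolding polyfam_def by (meson le_imp_less_Suc)
  with F have "\<exists>s Q R. polyfam I Q \<and> polyfam I R \<and> (\<forall>w. degree (R w) < d) \<and>
      (\<forall>w. smult (coeff (G w) d ^ s) (F w) = Q w * G w + R w)"
  proof (induction e arbitrary: F)
    case 0
    thus ?case by simp
  next
    case (Suc e)
    show ?case
    proof (cases "e < d")
      case True
      have "degree (F w) < d" for w using Suc.prems(2)[of w] True by simp
      moreover have "polyfam I (\<lambda>w. 0)"
        using polyfam_monom[OF polyfun.const[of _ 0], of I 0] by simp
      ultimately show ?thesis using Suc.prems(1)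
        by (intro exI[of _ 0] exI[of _ "\<lambda>_. 0"] exI[of _ F]) auto
    next
      case False
      \<comment> \<open>cross-multiplying by the leading coefficients cancels the term of degree \<open>e\<close>\<close>
      define c where "c = (\<lambda>w. monom (coeff (F w) e) (e - d))"
      define F' where "F' = (\<lambda>w. [:coeff (G w) d:] * F w - c w * G w)"
      have c: "polyfam I c" unfolding c_def by (intro polyfam_monom polyfam_coeff Suc.prems)
      have F': "polyfam I F'" unfolding F'_def
        by (intro polyfam_diff polyfam_mult polyfam_const polyfam_coeff c G Suc.prems)
      have "degree (F' w) < e" for w
      proof -
        have "coeff (F' w) i = 0" if "i \<ge> e" for i
        proof (cases "i = e")
          case True
          thus ?thesis using False by (simp add: F'_def c_def coeff_monom_mult)
        next
          case False
          hence "coeff (F w) i = 0" "coeff (G w) (i - (e - d)) = 0"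
            using that \<open>\<not> e < d\<close> Suc.prems(2)[of w] G(2)[of w] by (auto intro!: coeff_eq_0)
          thus ?thesis by (simp add: F'_def c_def coeff_monom_mult)
        qed
        thus ?thesis using False d by (intro degree_lessI) auto
      qed
      from Suc.IH[OF F' this] obtain s Q R where
        *: "polyfam I Q" "polyfam I R" "\<And>w. degree (R w) < d"
        "\<And>w. smult (coeff (G w) d ^ s) (F' w) = Q w * G w + R w" by blast
      let ?Q = "\<lambda>w. Q w + [:coeff (G w) d ^ s:] * c w"
      have "smult (coeff (G w) d ^ Suc s) (F w) = ?Q w * G w + R w" for w
        using *(4)[of w] by (simp add: F'_def smult_diff_right algebra_simps)
      moreover have "polyfam I ?Q"
        by (intro polyfam_add polyfam_mult polyfam_const polyfun_power polyfam_coeff * c G)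
      ultimately show ?thesis using *(2,3) by blast
    qed
  qed
  thus thesis using that by blast
qed

lemma dvd_power_degree_if_roots:
  fixes g h :: "'k::alg_closed_field poly"
  assumes "g \<noteq> 0" "\<And>x. poly g x = 0 \<Longrightarrow> poly h x = 0"
  shows "g dvd h ^ degree g"
  using assms
proof (induction "degree g" arbitrary: g)
  case 0
  thus ?case by (metis is_unit_iff_degree dvd_trans one_dvd)
next
  case (Suc d)
  then obtain x where x: "poly g x = 0" using alg_closed_imp_poly_has_root[of g] by auto
  then obtain g' where g': "g = [:-x, 1:] * g'" by (auto simp: poly_eq_0_iff_dvd)
  have "g' \<noteq> 0" using Suc.prems(1) g' by auto
  hence deg: "degree g = Suc (degree g')" unfolding g' by (subst degree_mult_eq) auto
  hence "g' dvd h ^ degree g'"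
    using Suc.hyps Suc.prems(2) \<open>g' \<noteq> 0\<close> by (intro Suc.hyps(1)) (simp_all add: g')
  moreover have "[:-x, 1:] dvd h" using Suc.prems(2)[OF x] by (simp only: poly_eq_0_iff_dvd)
  ultimately have "[:-x, 1:] * g' dvd h * h ^ degree g'" by (rule mult_dvd_mono[rotated])
  thus ?case unfolding deg power_Suc by (simp only: g')
qed

definition vanishing_fam :: "'v set \<Rightarrow> ('v \<Rightarrow> 'k::field) set \<Rightarrow> 'v \<Rightarrow> (('v \<Rightarrow> 'k) \<Rightarrow> 'k poly) \<Rightarrow> bool" where
  "vanishing_fam I Z j F \<longleftrightarrow> polyfam I F \<and> (\<forall>z\<in>Z. poly (F z) (z j) = 0)"

text \<open>
  For irreducible \<open>Z\<close> the least relation degree is the degree of the \<open>j\<close>-th coordinate over the field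
  of fractions of the functions in \<open>I\<close>. There is none if that coordinate is transcendental.
\<close>

definition relation_degree :: "'v set \<Rightarrow> ('v \<Rightarrow> 'k::field) set \<Rightarrow> 'v \<Rightarrow> nat \<Rightarrow> bool" where
  "relation_degree I Z j d \<longleftrightarrow>
     (\<exists>F. vanishing_fam I Z j F \<and> (\<forall>w. degree (F w) \<le> d) \<and> (\<exists>z\<in>Z. coeff (F z) d \<noteq> 0))"

text \<open>
  Otherwise cutting \<open>F\<close> off above its highest coefficient that does not vanish identically on \<open>Z\<close>
  would give a relation of degree at most \<open>D\<close>.
\<close>

lemma vanishing_fam_trivial:
  assumes F: "vanishing_fam I Z j F" "\<And>w. degree (F w) \<le> D"
    and D: "\<And>d. d \<le> D \<Longrightarrow> \<not> relation_degree I Z j d" and "z \<in> Z"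
  shows "coeff (F z) i = 0"
proof (rule ccontr)
  assume nz: "coeff (F z) i \<noteq> 0"
  define S where "S = {i. \<exists>z\<in>Z. coeff (F z) i \<noteq> 0}"
  have S: "S \<subseteq> {..D}" "i \<in> S"
    using F(2) nz \<open>z \<in> Z\<close> by (auto simp: S_def intro: order_trans[OF le_degree])
  hence "finite S" "S \<noteq> {}" by (auto intro: finite_subset)
  define e where "e = Max S"
  have e: "e \<in> S" unfolding e_def using \<open>finite S\<close> \<open>S \<noteq> {}\<close> by (rule Max_in)
  define H where "H = (\<lambda>w. poly_cutoff (Suc e) (F w))"
  have H: "H z = F z" if "z \<in> Z" for z
  proof (rule poly_eqI)
    fix i
    have "coeff (F z) i = 0" if "i > e"
      using Max_ge[OF \<open>finite S\<close>, of i] \<open>z \<in> Z\<close> that unfolding e_def S_def by force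
    thus "coeff (H z) i = coeff (F z) i" by (auto simp: H_def coeff_poly_cutoff)
  qed
  have "relation_degree I Z j e"
    unfolding relation_degree_def
  proof (intro exI[of _ H] conjI allI)
    show "vanishing_fam I Z j H"
      using F(1) H unfolding vanishing_fam_def by (auto simp: H_def intro: polyfam_cutoff)
    show "degree (H w) \<le> e" for w
      by (rule degree_le) (auto simp: H_def coeff_poly_cutoff)
    show "\<exists>z\<in>Z. coeff (H z) e \<noteq> 0" using e H by (auto simp: S_def)
  qed
  with D S(1) e show False by auto
qed

text \<open>
  Lifting a point from the closure of a projection along one coordinate. Either the new coordinate
  is transcendental over the old ones on \<open>Z\<close> and can take all but finitely many values, or it
  satisfies a relation of least degree, and any root of that relation at which \<open>b\<close> does not vanish
  will do: by pseudo-division, modulo that relation every function is a family of smaller degree, to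
  which the previous lemma applies.
\<close>

lemma extend_point_one_variable:
  fixes Z :: "('v \<Rightarrow> 'k::alg_closed_field) set"
  assumes irr: "irred_on (insert j I) Z" and j: "j \<notin> I"
    and b: "polyfun (insert j I) b" "\<exists>z\<in>Z. b z \<noteq> 0"
  obtains a where "polyfun I a" "\<exists>z\<in>Z. a z \<noteq> 0"
    "\<And>w. in_closure I Z w \<Longrightarrow> a w \<noteq> 0 \<Longrightarrow>
       \<exists>t. in_closure (insert j I) Z (w(j := t)) \<and> b (w(j := t)) \<noteq> 0"
proof -
  obtain B where B: "polyfam I B" "\<And>w t. b (w(j := t)) = poly (B w) t"
    using polyfun_as_polyfam[OF b(1) j] by blast
  have Bz: "b z = poly (B z) (z j)" for z using B(2)[of z "z j"] by simp
  have closure_if: "in_closure (insert j I) Z (w(j := t))"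
    if "\<And>F. vanishing_fam I Z j F \<Longrightarrow> poly (F w) t = 0" for w t
    unfolding in_closure_def
  proof (intro allI impI)
    fix p assume p: "polyfun (insert j I) p" "\<forall>z\<in>Z. p z = 0"
    obtain F where F: "polyfam I F" "\<And>w t. p (w(j := t)) = poly (F w) t"
      using polyfun_as_polyfam[OF p(1) j] by blast
    have "poly (F z) (z j) = 0" if "z \<in> Z" for z
      using F(2)[of z "z j"] p(2) that by simp
    with F(1) have "vanishing_fam I Z j F" by (simp add: vanishing_fam_def)
    from that[OF this] show "p (w(j := t)) = 0" by (simp add: F(2))
  qed
  show thesis
  proof (cases "\<exists>d. relation_degree I Z j d")
    case False
    obtain z0 where z0: "z0 \<in> Z" "b z0 \<noteq> 0" using b(2) by blast
    hence "B z0 \<noteq> 0" using Bz[of z0] by auto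
    then obtain i where i: "coeff (B z0) i \<noteq> 0" by (auto simp: poly_eq_iff)
    show thesis
    proof (rule that[of "\<lambda>w. coeff (B w) i"])
      show "polyfun I (\<lambda>w. coeff (B w) i)" by (rule polyfam_coeff[OF B(1)])
      show "\<exists>z\<in>Z. coeff (B z) i \<noteq> 0" using i z0 by blast
      fix w assume w: "in_closure I Z w" "coeff (B w) i \<noteq> 0"
      hence "B w \<noteq> 0" by auto
      then obtain t where t: "poly (B w) t \<noteq> 0" using poly_nonzero_value by blast
      have "in_closure (insert j I) Z (w(j := t))"
      proof (rule closure_if)
        fix F assume F: "vanishing_fam I Z j F"
        then obtain D where D: "\<And>w. degree (F w) \<le> D" unfolding vanishing_fam_def polyfam_def by blast
        have "coeff (F w) i = 0" for i
          using w(1) polyfam_coeff[of I F i] F vanishing_fam_trivial[OF F D] False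
          unfolding in_closure_def vanishing_fam_def by blast
        hence "F w = 0" by (simp add: poly_eq_iff)
        thus "poly (F w) t = 0" by simp
      qed
      with t show "\<exists>t. in_closure (insert j I) Z (w(j := t)) \<and> b (w(j := t)) \<noteq> 0"
        unfolding B(2) by blast
    qed
  next
    case True
    define d where "d = (LEAST d. relation_degree I Z j d)"
    have "relation_degree I Z j d" unfolding d_def using True by (rule LeastI_ex)
    then obtain G where G: "polyfam I G" "\<And>z. z \<in> Z \<Longrightarrow> poly (G z) (z j) = 0"
        "\<And>w. degree (G w) \<le> d" "\<exists>z\<in>Z. coeff (G z) d \<noteq> 0"
      unfolding relation_degree_def vanishing_fam_def by blast
    have least: "\<not> relation_degree I Z j d'" if "d' < d" for d'
      using not_less_Least that unfolding d_def by blast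
    have d: "d > 0"
    proof (rule ccontr)
      assume "\<not> d > 0"
      hence "degree (G z) = 0" for z using G(3)[of z] by simp
      hence "coeff (G z) 0 = poly (G z) (z j)" for z 
        by (metis degree_eq_zeroE coeff_pCons_0 poly_pCons poly_0 mult_zero_right add.right_neutral)
      with G(2,4) \<open>\<not> d > 0\<close> show False by auto
    qed
    have small: "coeff (R w) i = 0"
      if "vanishing_fam I Z j R" "\<And>w. degree (R w) < d" "in_closure I Z w" for R w i
    proof -
      have "degree (R w) \<le> d - 1" for w using that(2)[of w] by simp
      hence "\<forall>z\<in>Z. coeff (R z) i = 0" 
        using vanishing_fam_trivial[OF that(1), of "d - 1"] least d by force
      thus ?thesis using that(1,3) polyfam_coeff[of I R i] unfolding in_closure_def vanishing_fam_def by blast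
    qed
    obtain s Q R where R: "polyfam I Q" "polyfam I R" "\<And>w. degree (R w) < d"
        "\<And>w. smult (coeff (G w) d ^ s) (B w ^ d) = Q w * G w + R w"
      using polyfam_pseudo_division[OF G(1,3) d polyfam_power[OF B(1)]] by metis
    obtain z where z: "z \<in> Z" "coeff (G z) d \<noteq> 0" "b z \<noteq> 0"
      using irred_onD[OF irr polyfun_mono[OF polyfam_coeff[OF G(1)]] b(1) G(4) b(2)] by blast
    have "coeff (G z) d ^ s * b z ^ d = poly (R z) (z j)"
      using arg_cong[OF R(4)[of z], of "\<lambda>p. poly p (z j)"] z(1) G(2) by (simp add: Bz)
    moreover have "coeff (G z) d ^ s * b z ^ d \<noteq> 0" using z by simp
    ultimately have "R z \<noteq> 0" by auto
    then obtain i where i: "coeff (R z) i \<noteq> 0" by (auto simp: poly_eq_iff)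
    let ?a = "\<lambda>w. coeff (G w) d * coeff (R w) i"
    show thesis
    proof (rule that[of ?a])
      show "polyfun I ?a" by (intro polyfun.mult polyfam_coeff G R)
      show "\<exists>z\<in>Z. ?a z \<noteq> 0" using z i by auto
      fix w assume w: "in_closure I Z w" "?a w \<noteq> 0"
      hence degG: "degree (G w) = d" using G(3)[of w] le_degree[of "G w" d] by auto
      hence "G w \<noteq> 0" using d by auto
      \<comment> \<open>otherwise \<open>G w\<close> divides a power of \<open>B w\<close>, hence the remainder \<open>R w\<close> of smaller degree\<close>
      have "\<exists>t. poly (G w) t = 0 \<and> poly (B w) t \<noteq> 0"
      proof (rule ccontr)
        assume "\<not> ?thesis"
        hence "G w dvd B w ^ d" using dvd_power_degree_if_roots[OF \<open>G w \<noteq> 0\<close>, of "B w"] degG by auto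
        hence "G w dvd smult (coeff (G w) d ^ s) (B w ^ d) - Q w * G w"
          by (intro dvd_diff dvd_smult) auto
        hence "G w dvd R w" by (simp add: R(4))
        moreover have "R w \<noteq> 0" using w(2) by auto
        ultimately have "d \<le> degree (R w)" using dvd_imp_degree_le degG by blast
        with R(3)[of w] show False by simp
      qed
      then obtain t where t: "poly (G w) t = 0" "poly (B w) t \<noteq> 0" by blast
      have "in_closure (insert j I) Z (w(j := t))"
      proof (rule closure_if)
        fix F assume F: "vanishing_fam I Z j F"
        obtain s' Q' R' where R': "polyfam I Q'" "polyfam I R'" "\<And>w. degree (R' w) < d"
          "\<And>w. smult (coeff (G w) d ^ s') (F w) = Q' w * G w + R' w"
          using polyfam_pseudo_division[OF G(1,3) d] F unfolding vanishing_fam_def by metis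
        have "poly (R' z) (z j) = 0" if "z \<in> Z" for z
          using arg_cong[OF R'(4)[of z], of "\<lambda>p. poly p (z j)"] that G(2) F
          by (simp add: vanishing_fam_def)
        with R'(2) have "vanishing_fam I Z j R'" by (simp add: vanishing_fam_def)
        hence "R' w = 0" using small[OF _ R'(3) w(1)] by (auto simp: poly_eq_iff)
        thus "poly (F w) t = 0"
          using arg_cong[OF R'(4)[of w], of "\<lambda>p. poly p t"] w(2) t(1) by auto
      qed
      with t show "\<exists>t. in_closure (insert j I) Z (w(j := t)) \<and> b (w(j := t)) \<noteq> 0"
        unfolding B(2) by blast
    qed
  qed
qed

lemma extend_point:
  fixes Z :: "('v \<Rightarrow> 'k::alg_closed_field) set"
  assumes "finite K" "I \<inter> K = {}" "irred_on (I \<union> K) Z" "polyfun (I \<union> K) b" "\<exists>z\<in>Z. b z \<noteq> 0"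
  shows "\<exists>a. polyfun I a \<and> (\<exists>z\<in>Z. a z \<noteq> 0) \<and> (\<forall>w. in_closure I Z w \<longrightarrow> a w \<noteq> 0 \<longrightarrow>
     (\<exists>w'. (\<forall>i\<in>I. w' i = w i) \<and> in_closure (I \<union> K) Z w' \<and> b w' \<noteq> 0))"
  using assms
proof (induction K arbitrary: b rule: finite_induct)
  case empty
  thus ?case by (intro exI[of _ b]) auto
next
  case (insert j K)
  have eq: "I \<union> insert j K = insert j (I \<union> K)" by auto
  have j: "j \<notin> I \<union> K" using insert by auto
  obtain c where c: "polyfun (I \<union> K) c" "\<exists>z\<in>Z. c z \<noteq> 0"
    "\<And>w. in_closure (I \<union> K) Z w \<Longrightarrow> c w \<noteq> 0 \<Longrightarrow>
       \<exists>t. in_closure (I \<union> insert j K) Z (w(j := t)) \<and> b (w(j := t)) \<noteq> 0"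
    using extend_point_one_variable[OF insert.prems(2)[unfolded eq] j insert.prems(3)[unfolded eq]
        insert.prems(4)] unfolding eq by blast
  have "irred_on (I \<union> K) Z" by (rule irred_on_mono[OF insert.prems(2)]) auto
  from insert.IH[OF _ this c(1,2)] insert.prems(1) obtain a where
    a: "polyfun I a" "\<exists>z\<in>Z. a z \<noteq> 0" "\<And>w. in_closure I Z w \<Longrightarrow> a w \<noteq> 0 \<Longrightarrow>
     \<exists>w'. (\<forall>i\<in>I. w' i = w i) \<and> in_closure (I \<union> K) Z w' \<and> c w' \<noteq> 0" by auto
  show ?case
  proof (intro exI[of _ a] conjI allI impI a(1,2))
    fix w assume "in_closure I Z w" "a w \<noteq> 0"
    then obtain w' where w': "\<forall>i\<in>I. w' i = w i" "in_closure (I \<union> K) Z w'" "c w' \<noteq> 0"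
      using a(3) by blast
    then obtain t where "in_closure (I \<union> insert j K) Z (w'(j := t))" "b (w'(j := t)) \<noteq> 0"
      using c(3) by blast
    thus "\<exists>w'. (\<forall>i\<in>I. w' i = w i) \<and> in_closure (I \<union> insert j K) Z w' \<and> b w' \<noteq> 0"
      using w'(1) j by (intro exI[of _ "w'(j := t)"]) auto
  qed
qed

section \<open>Closed subsets of projective space\<close>

lemma point_of_self [simp]: "v \<in> point_of (v :: nat \<Rightarrow> 'k::field)"
  unfolding point_of_def by (auto intro!: exI[of _ 1])

lemma point_of_scale: "c \<noteq> 0 \<Longrightarrow> point_of (\<lambda>i. c * v i) = point_of (v :: nat \<Rightarrow> 'k::field)"
proof -
  assume c: "c \<noteq> 0"
  have "\<exists>d. (\<lambda>i. b * v i) = (\<lambda>i. d * (c * v i)) \<and> d \<noteq> 0" if "b \<noteq> 0" for b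
    using that c by (intro exI[of _ "b / c"]) auto
  moreover have "\<exists>d. (\<lambda>i. b * (c * v i)) = (\<lambda>i. d * v i) \<and> d \<noteq> 0" if "b \<noteq> 0" for b
    using that c by (intro exI[of _ "b * c"]) (auto simp: mult.assoc)
  ultimately show ?thesis unfolding point_of_def by blast
qed

lemma point_of_mem:
  assumes "u \<in> point_of (v :: nat \<Rightarrow> 'k::field)" shows "point_of u = point_of v"
proof -
  obtain c where "u = (\<lambda>i. c * v i)" "c \<noteq> 0" using assms by (auto simp: point_of_def)
  thus ?thesis using point_of_scale by simp
qed

lemma proj_space_coords:
  assumes "x \<in> proj_space n" "v \<in> x"
  shows "x = point_of v" "v \<in> coord_space n" "v \<noteq> (\<lambda>_. 0)"
proof -
  obtain u where u: "x = point_of u" "u \<in> coord_space n" "u \<noteq> (\<lambda>_. 0)"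
    using assms(1) unfolding proj_space_def by blast
  thus "x = point_of v" using point_of_mem assms(2) by blast
  obtain c where "v = (\<lambda>i. c * u i)" "c \<noteq> 0" using assms(2) u(1) by (auto simp: point_of_def)
  thus "v \<in> coord_space n" "v \<noteq> (\<lambda>_. 0)" using u by (auto simp: coord_space_def fun_eq_iff)
qed

lemma proj_spaceI: "v \<in> coord_space n \<Longrightarrow> v \<noteq> (\<lambda>_. 0) \<Longrightarrow> point_of v \<in> proj_space n"
  by (auto simp: proj_space_def)

lemma proj_space_nonempty: "x \<in> proj_space n \<Longrightarrow> \<exists>v. v \<in> x"
  by (auto simp: proj_space_def intro: point_of_self)

lemma proj_closed_subset: "proj_closed n X \<Longrightarrow> X \<subseteq> proj_space n"
  by (auto simp: proj_closed_def zero_locus_def)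

text \<open>
  Polynomial functions that are not homogeneous may be used to separate a point from a closed set:
  they may be replaced by one of their homogeneous components, because the field is infinite.
\<close>

lemma proj_closedI:
  fixes X :: "'k::alg_closed_field point set"
  assumes X: "X \<subseteq> proj_space n"
    and sep: "\<And>x. x \<in> proj_space n \<Longrightarrow> x \<notin> X \<Longrightarrow>
      \<exists>p. polyfun {..n} p \<and> (\<exists>v\<in>x. p v \<noteq> 0) \<and> (\<forall>y\<in>X. \<forall>u\<in>y. p u = 0)"
  shows "proj_closed n X"
  unfolding proj_closed_def
proof (intro exI conjI)
  let ?S = "{q. (\<exists>d. form n d q) \<and> (\<forall>y\<in>X. \<forall>u\<in>y. eval q u = 0)}"
  show "\<forall>p\<in>?S. \<exists>d. form n d p" by blast
  show "X = zero_locus n ?S"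
  proof (intro equalityI subsetI)
    fix x assume "x \<in> X" thus "x \<in> zero_locus n ?S" using X by (auto simp: zero_locus_def)
  next
    fix x assume x: "x \<in> zero_locus n ?S"
    show "x \<in> X"
    proof (rule ccontr)
      assume "x \<notin> X"
      moreover have "x \<in> proj_space n" using x by (simp add: zero_locus_def)
      ultimately obtain p v where p: "polyfun {..n} p" "v \<in> x" "p v \<noteq> 0" "\<forall>y\<in>X. \<forall>u\<in>y. p u = 0"
        using sep by blast
      obtain P where P: "\<And>c v. p (\<lambda>i. c * v i) = poly (P v) c" "\<And>d. formfun n d (\<lambda>v. coeff (P v) d)"
        using polyfun_homogeneous_components[OF p(1)] by blast
      have "P u = 0" if "y \<in> X" "u \<in> y" for y u
      proof (rule ccontr)
        assume "P u \<noteq> 0"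
        then obtain c where c: "c \<noteq> 0" "poly (P u) c \<noteq> 0" using poly_nonzero_value by blast
        have "y = point_of u" using proj_space_coords that X by blast
        hence "(\<lambda>i. c * u i) \<in> y" using c(1) by (auto simp: point_of_def)
        with p(4) that c(2) P(1)[of c u] show False by auto
      qed
      moreover have "P v \<noteq> 0" using P(1)[of 1 v] p(3) by auto
      then obtain d where d: "coeff (P v) d \<noteq> 0" by (auto simp: poly_eq_iff)
      obtain q where q: "form n d q" "(\<lambda>v. coeff (P v) d) = eval q" using P(2) unfolding formfun_def by blast
      ultimately have "q \<in> ?S" by (auto simp flip: q(2))
      hence "eval q v = 0" using x p(2) unfolding zero_locus_def by blast
      thus False using d by (simp flip: q(2))
    qed
  qed
qed

lemma proj_closed_separating_form:
  assumes "proj_closed n X" "x \<in> proj_space n" "x \<notin> X"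
  obtains d f where "formfun n d f" "\<And>v. v \<in> x \<Longrightarrow> f v \<noteq> 0" "\<And>y u. y \<in> X \<Longrightarrow> u \<in> y \<Longrightarrow> f u = 0"
proof -
  obtain S where S: "\<forall>p\<in>S. \<exists>d. form n d p" "X = zero_locus n S"
    using assms(1) unfolding proj_closed_def by blast
  then obtain p v d where p: "p \<in> S" "v \<in> x" "eval p v \<noteq> 0" "form n d p"
    using assms(2,3) by (auto simp: zero_locus_def)
  have ff: "formfun n d (eval p)" by (rule formfunI[OF p(4)])
  have "eval p u \<noteq> 0" if u: "u \<in> x" for u
  proof -
    obtain c where "c \<noteq> 0" "u = (\<lambda>i. c * v i)"
      using u unfolding proj_space_coords(1)[OF assms(2) p(2)] point_of_def by blast
    thus ?thesis using formfun_scale[OF ff] p(3) by auto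
  qed
  moreover have "eval p u = 0" if "y \<in> X" "u \<in> y" for y u
    using that p(1) by (auto simp: S(2) zero_locus_def)
  ultimately show thesis using that ff by blast
qed

lemma proj_closed_zeros:
  fixes p :: "(nat \<Rightarrow> 'k::alg_closed_field) \<Rightarrow> 'k"
  assumes "polyfun {..n} p"
  shows "proj_closed n {x \<in> proj_space n. \<forall>v\<in>x. p v = 0}"
  using assms by (intro proj_closedI) auto

lemma proj_closed_Un:
  fixes A B :: "'k::alg_closed_field point set"
  assumes A: "proj_closed n A" and B: "proj_closed n B"
  shows "proj_closed n (A \<union> B)"
proof (rule proj_closedI)
  show "A \<union> B \<subseteq> proj_space n" using assms proj_closed_subset by auto
  fix x assume x: "x \<in> proj_space n" "x \<notin> A \<union> B"
  obtain d f where f: "formfun n d f" "\<And>v. v \<in> x \<Longrightarrow> f v \<noteq> 0" "\<And>y u. y \<in> A \<Longrightarrow> u \<in> y \<Longrightarrow> f u = 0"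
    using proj_closed_separating_form[OF A x(1)] x(2) by blast
  obtain e g where g: "formfun n e g" "\<And>v. v \<in> x \<Longrightarrow> g v \<noteq> 0" "\<And>y u. y \<in> B \<Longrightarrow> u \<in> y \<Longrightarrow> g u = 0"
    using proj_closed_separating_form[OF B x(1)] x(2) by blast
  obtain v where "v \<in> x" using proj_space_nonempty x(1) by blast
  with f g show "\<exists>p. polyfun {..n} p \<and> (\<exists>v\<in>x. p v \<noteq> 0) \<and> (\<forall>y\<in>A \<union> B. \<forall>u\<in>y. p u = 0)"
    by (intro exI[of _ "\<lambda>v. f v * g v"]) (auto intro!: polyfun.mult intro: formfun_polyfun)
qed

definition proj_closure :: "nat \<Rightarrow> 'k::field point set \<Rightarrow> 'k point set" where
  "proj_closure n P = \<Inter>{C. proj_closed n C \<and> P \<subseteq> C}"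

lemma proj_closure_subset: "P \<subseteq> proj_closure n P"
  by (auto simp: proj_closure_def)

lemma proj_closure_minimal: "proj_closed n C \<Longrightarrow> P \<subseteq> C \<Longrightarrow> proj_closure n P \<subseteq> C"
  by (auto simp: proj_closure_def)

lemma proj_closed_closure:
  fixes P :: "'k::alg_closed_field point set"
  assumes "P \<subseteq> proj_space n"
  shows "proj_closed n (proj_closure n P)"
proof (rule proj_closedI)
  have "proj_closed n (proj_space n :: 'k point set)"
    using proj_closed_zeros[OF polyfun.const[of _ 0]] by simp
  thus "proj_closure n P \<subseteq> proj_space n" using assms by (rule proj_closure_minimal)
  fix x assume x: "x \<in> proj_space n" "x \<notin> proj_closure n P"
  then obtain C where C: "proj_closed n C" "P \<subseteq> C" "x \<notin> C" by (auto simp: proj_closure_def)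
  obtain d f where f: "formfun n d f" "\<And>v. v \<in> x \<Longrightarrow> f v \<noteq> 0" "\<And>y u. y \<in> C \<Longrightarrow> u \<in> y \<Longrightarrow> f u = 0"
    using proj_closed_separating_form[OF C(1) x(1) C(3)] by blast
  obtain v where "v \<in> x" using proj_space_nonempty x(1) by blast
  with f proj_closure_minimal[OF C(1,2)]
  show "\<exists>p. polyfun {..n} p \<and> (\<exists>v\<in>x. p v \<noteq> 0) \<and> (\<forall>y\<in>proj_closure n P. \<forall>u\<in>y. p u = 0)"
    by (intro exI[of _ f]) (auto intro: formfun_polyfun)
qed

lemma proj_irreducible_closure:
  assumes "proj_irreducible n P"
  shows "proj_irreducible n (proj_closure n P)"
  unfolding proj_irreducible_def
proof (intro conjI allI impI)
  show "proj_closure n P \<noteq> {}"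
    using assms proj_closure_subset[of P n] unfolding proj_irreducible_def by blast
  fix A B assume AB: "proj_closed n A" "proj_closed n B" "proj_closure n P \<subseteq> A \<union> B"
  hence "P \<subseteq> A \<or> P \<subseteq> B"
    using assms proj_closure_subset[of P n] unfolding proj_irreducible_def by blast
  thus "proj_closure n P \<subseteq> A \<or> proj_closure n P \<subseteq> B"
    using AB proj_closure_minimal by blast
qed

text \<open>
  Projective irreducibility concerns forms only. For arbitrary polynomials \<open>p\<close> and \<open>q\<close>, first find
  a point at which some homogeneous component of each does not vanish, then scale its coordinates.
\<close>

lemma irred_on_cone:
  fixes X :: "'k::alg_closed_field point set"
  assumes X: "X \<subseteq> proj_space n" "proj_irreducible n X"
  shows "irred_on {..n} (\<Union>X)"
  unfolding irred_on_def
proof (intro conjI allI impI)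
  show "\<Union>X \<noteq> {}" using X proj_space_nonempty unfolding proj_irreducible_def by fastforce
  fix p q assume p: "polyfun {..n} p" "\<exists>z\<in>\<Union>X. p z \<noteq> 0" and q: "polyfun {..n} q" "\<exists>z\<in>\<Union>X. q z \<noteq> 0"
  obtain P where P: "\<And>c v. p (\<lambda>i. c * v i) = poly (P v) c" "\<And>d. formfun n d (\<lambda>v. coeff (P v) d)"
    using polyfun_homogeneous_components[OF p(1)] by blast
  obtain Q where Q: "\<And>c v. q (\<lambda>i. c * v i) = poly (Q v) c" "\<And>d. formfun n d (\<lambda>v. coeff (Q v) d)"
    using polyfun_homogeneous_components[OF q(1)] by blast
  obtain x v where v: "x \<in> X" "v \<in> x" "p v \<noteq> 0" using p(2) by blast
  obtain y u where u: "y \<in> X" "u \<in> y" "q u \<noteq> 0" using q(2) by blast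
  have "P v \<noteq> 0" using v(3) P(1)[of 1 v] by auto
  then obtain d where d: "coeff (P v) d \<noteq> 0" by (auto simp: poly_eq_iff)
  have "Q u \<noteq> 0" using u(3) Q(1)[of 1 u] by auto
  then obtain e where e: "coeff (Q u) e \<noteq> 0" by (auto simp: poly_eq_iff)
  let ?A = "{x \<in> proj_space n. \<forall>v\<in>x. coeff (P v) d = 0}"
  let ?B = "{x \<in> proj_space n. \<forall>v\<in>x. coeff (Q v) e = 0}"
  have "proj_closed n ?A" "proj_closed n ?B"
    by (intro proj_closed_zeros formfun_polyfun[OF P(2)] formfun_polyfun[OF Q(2)])+
  moreover have "\<not> X \<subseteq> ?A" using v d by blast
  moreover have "\<not> X \<subseteq> ?B" using u e by blast
  ultimately have "\<not> X \<subseteq> ?A \<union> ?B" using X(2) unfolding proj_irreducible_def by blast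
  then obtain z where z: "z \<in> X" "z \<notin> ?A" "z \<notin> ?B" by blast
  then obtain w w' where w: "w \<in> z" "w' \<in> z" "coeff (P w) d \<noteq> 0" "coeff (Q w') e \<noteq> 0"
    using X(1) by blast
  then obtain b where b: "b \<noteq> 0" "w' = (\<lambda>i. b * w i)"
    using proj_space_coords(1)[of z n w] z X(1) by (auto simp: point_of_def)
  have "coeff (Q w) e \<noteq> 0" using formfun_scale[OF Q(2)[of e], of b w] w(4) unfolding b(2) by auto
  hence "P w * Q w \<noteq> 0" using w(3) by auto
  then obtain c where c: "c \<noteq> 0" "poly (P w * Q w) c \<noteq> 0" using poly_nonzero_value by blast
  have "(\<lambda>i. c * w i) \<in> z"
    using proj_space_coords(1)[of z n w] z w(1) X(1) c(1) by (auto simp: point_of_def)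
  with z(1) c(2) show "\<exists>z\<in>\<Union>X. p z \<noteq> 0 \<and> q z \<noteq> 0"
    by (intro bexI[of _ "\<lambda>i. c * w i"]) (auto simp: P(1) Q(1))
qed

section \<open>Chains of irreducible closed sets\<close>

text \<open>
  Why monomials in functions \<open>g 0, g 1, \<dots>\<close> that separate successive members of the chain are
  linearly independent: divide by the lowest power of the last \<open>g r\<close>, then restrict to \<open>C r\<close>.
\<close>

lemma chain_monomials_independent:
  fixes g :: "nat \<Rightarrow> ('v \<Rightarrow> 'k::field) \<Rightarrow> 'k"
  assumes C: "\<And>i. i \<le> r \<Longrightarrow> irred_on J (C i)" "\<And>i. i < r \<Longrightarrow> C i \<subseteq> C (Suc i)"
    and g: "\<And>i. i < r \<Longrightarrow> polyfun J (g i)" "\<And>i x. i < r \<Longrightarrow> x \<in> C i \<Longrightarrow> g i x = 0"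
      "\<And>i. i < r \<Longrightarrow> \<exists>x\<in>C (Suc i). g i x \<noteq> 0"
    and rel: "\<And>x. x \<in> C r \<Longrightarrow> (\<Sum>a\<in>{..<r} \<rightarrow>\<^sub>E {..<D}. c a * (\<Prod>i<r. g i x ^ a i)) = 0"
    and a: "a \<in> {..<r} \<rightarrow>\<^sub>E {..<D}"
  shows "c a = 0"
  using C g rel a
proof (induction r arbitrary: c a)
  case 0
  obtain x where "x \<in> C 0" using "0.prems"(1)[of 0] by (auto simp: irred_on_def)
  with "0.prems"(6)[of x] "0.prems"(7) show ?case by simp
next
  case (Suc r)
  let ?A = "{..<r} \<rightarrow>\<^sub>E {..<D}"
  define Q where "Q = (\<lambda>j x. \<Sum>a\<in>?A. c (a(r := j)) * (\<Prod>i<r. g i x ^ a i))"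
  have IH: "c (a(r := j)) = 0" if "\<And>x. x \<in> C r \<Longrightarrow> Q j x = 0" "a \<in> ?A" for j a
    using Suc.IH[of "\<lambda>a. c (a(r := j))" a] Suc.prems(1-5) that by (simp add: Q_def)
  have Qpoly: "polyfun J (Q j)" for j
    unfolding Q_def by (intro polyfun_sum polyfun.mult polyfun.const polyfun_prod polyfun_power Suc.prems) auto
  have split: "(\<Sum>a\<in>{..<Suc r} \<rightarrow>\<^sub>E {..<D}. c a * (\<Prod>i<Suc r. g i x ^ a i)) = (\<Sum>j<D. Q j x * g r x ^ j)" for x
  proof -
    have "(\<Sum>a\<in>{..<Suc r} \<rightarrow>\<^sub>E {..<D}. c a * (\<Prod>i<Suc r. g i x ^ a i))
        = (\<Sum>(j, a)\<in>{..<D} \<times> ?A. c (a(r := j)) * (\<Prod>i<Suc r. g i x ^ (a(r := j)) i))"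
      unfolding lessThan_Suc PiE_insert_eq
      by (subst sum.reindex[OF inj_combinator]) (auto simp: case_prod_unfold)
    also have "\<dots> = (\<Sum>j<D. \<Sum>a\<in>?A. c (a(r := j)) * (\<Prod>i<r. g i x ^ a i) * g r x ^ j)"
      unfolding sum.cartesian_product[symmetric] by (intro sum.cong refl) simp
    also have "\<dots> = (\<Sum>j<D. Q j x * g r x ^ j)" by (simp add: Q_def sum_distrib_right)
    finally show ?thesis .
  qed
  have coeff: "\<forall>a\<in>?A. c (a(r := j)) = 0" if "j < D" for j
    using that
  proof (induction j rule: less_induct)
    case (less j)
    have lower: "Q l x = 0" if "l < j" for l x
    proof -
      have "\<forall>a\<in>?A. c (a(r := l)) = 0"
        by (rule less.IH[OF that order.strict_trans[OF that less.prems]])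
      thus ?thesis unfolding Q_def by (intro sum.neutral ballI) (simp only: mult_zero_left)
    qed
    define R where "R = (\<lambda>x. \<Sum>l\<in>{j..<D}. Q l x * g r x ^ (l - j))"
    have Rpoly: "polyfun J R"
      unfolding R_def by (intro polyfun_sum polyfun.mult polyfun_power Qpoly Suc.prems) auto
    have "g r x ^ j * R x = 0" if "x \<in> C (Suc r)" for x
    proof -
      have "g r x ^ j * R x = (\<Sum>l\<in>{j..<D}. Q l x * g r x ^ l)"
        unfolding R_def sum_distrib_left
        by (intro sum.cong refl) (simp flip: power_add)
      also have "\<dots> = (\<Sum>l<D. Q l x * g r x ^ l)"
        using lower by (intro sum.mono_neutral_left) auto
      finally show ?thesis using split[of x] Suc.prems(6)[OF that] by simp
    qed
    hence R0: "R x = 0" if "x \<in> C (Suc r)" for x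
      using irred_onD[OF Suc.prems(1)[OF order.refl] Suc.prems(3)[of r] Rpoly Suc.prems(5)[of r]] that by fastforce
    have "Q j x = 0" if "x \<in> C r" for x
    proof -
      have "R x = (\<Sum>l\<in>{j..<D}. if l = j then Q l x else 0)"
        unfolding R_def using Suc.prems(4)[of r x] that by (intro sum.cong refl) auto
      also have "\<dots> = Q j x" using less.prems by simp
      finally show ?thesis using R0[of x] that Suc.prems(2)[of r] by auto
    qed
    thus ?case using IH by blast
  qed
  obtain j b where "a = b(r := j)" "j < D" "b \<in> ?A"
    using Suc.prems(7) unfolding lessThan_Suc PiE_insert_eq by auto
  thus ?case using coeff by blast
qed

interpretation fun_space: vector_space "\<lambda>(c :: 'k::field) (f :: 'a \<Rightarrow> 'k) x. c * f x"
  by unfold_locales (auto simp: fun_eq_iff algebra_simps)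

lemma (in vector_space) nontrivial_relation:
  assumes "finite A" "finite B" "v ` A \<subseteq> span B" "card B < card A"
  shows "\<exists>c. (\<exists>a\<in>A. c a \<noteq> 0) \<and> (\<Sum>a\<in>A. scale (c a) (v a)) = 0"
proof (cases "inj_on v A")
  case True
  have "dependent (v ` A)"
    using independent_span_bound[OF assms(2) _ assms(3)] card_image[OF True] assms(4) by auto
  then obtain u where "\<exists>x\<in>v ` A. u x \<noteq> 0" "(\<Sum>x\<in>v ` A. scale (u x) x) = 0"
    using dependent_finite[of "v ` A"] assms(1) by auto
  thus ?thesis using True by (intro exI[of _ "\<lambda>a. u (v a)"]) (auto simp: sum.reindex)
next
  case False
  then obtain a b where ab: "a \<in> A" "b \<in> A" "a \<noteq> b" "v a = v b" by (auto simp: inj_on_def)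
  let ?c = "\<lambda>x. if x = a then 1 else if x = b then - 1 else 0"
  have "(\<Sum>x\<in>A. scale (?c x) (v x)) = (\<Sum>x\<in>{a, b}. scale (?c x) (v x))"
    using ab assms(1) by (intro sum.mono_neutral_right) auto
  also have "\<dots> = 0" using ab by simp
  finally show ?thesis using ab by (intro exI[of _ ?c]) auto
qed

text \<open>
  Each exponent is bounded separately; compared with a bound on the total degree this makes both
  counting and multiplying immediate.
\<close>

definition box_monomials :: "'v set \<Rightarrow> nat \<Rightarrow> (('v \<Rightarrow> 'k::field) \<Rightarrow> 'k) set" where
  "box_monomials J e = (\<lambda>m x. \<Prod>i\<in>J. x i ^ m i) ` (J \<rightarrow>\<^sub>E {..e})"

lemma box_monomials_card:
  assumes "finite J"
  shows "finite (box_monomials J e)" "card (box_monomials J e) \<le> Suc e ^ card J"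
proof -
  have "card (J \<rightarrow>\<^sub>E {..e}) = Suc e ^ card J" using assms by (simp add: card_funcsetE)
  moreover have fin: "finite (J \<rightarrow>\<^sub>E {..e})" using assms by (intro finite_PiE) auto
  ultimately show "card (box_monomials J e) \<le> Suc e ^ card J"
    unfolding box_monomials_def using card_image_le[OF fin] by simp
  show "finite (box_monomials J e)" unfolding box_monomials_def using fin by simp
qed

lemma box_monomials_mono: "e \<le> e' \<Longrightarrow> box_monomials J e \<subseteq> box_monomials J e'"
  unfolding box_monomials_def by (intro image_mono PiE_mono) auto

lemma box_monomials_mult:
  assumes "f \<in> box_monomials J e" "g \<in> box_monomials J e'"
  shows "(\<lambda>x. f x * g x) \<in> box_monomials J (e + e')"
proof -
  obtain m m' where m: "m \<in> J \<rightarrow>\<^sub>E {..e}" "f = (\<lambda>x. \<Prod>i\<in>J. x i ^ m i)"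
    "m' \<in> J \<rightarrow>\<^sub>E {..e'}" "g = (\<lambda>x. \<Prod>i\<in>J. x i ^ m' i)"
    using assms unfolding box_monomials_def by blast
  let ?m = "restrict (\<lambda>i. m i + m' i) J"
  have "?m \<in> J \<rightarrow>\<^sub>E {..e + e'}" using m(1,3) by (auto simp: PiE_iff intro!: add_mono)
  moreover have "(\<lambda>x. f x * g x) = (\<lambda>x. \<Prod>i\<in>J. x i ^ ?m i)"
    unfolding m by (auto simp: fun_eq_iff power_add simp flip: prod.distrib intro!: prod.cong)
  ultimately show ?thesis unfolding box_monomials_def by blast
qed

abbreviation box_span :: "'v set \<Rightarrow> nat \<Rightarrow> (('v \<Rightarrow> 'k::field) \<Rightarrow> 'k) set" where
  "box_span J e \<equiv> fun_space.span (box_monomials J e)"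

lemma box_span_mono: "f \<in> box_span J e \<Longrightarrow> e \<le> e' \<Longrightarrow> f \<in> box_span J e'"
  using fun_space.span_mono[OF box_monomials_mono] by blast

lemma box_span_add: "f \<in> box_span J e \<Longrightarrow> g \<in> box_span J e \<Longrightarrow> (\<lambda>x. f x + g x) \<in> box_span J e"
  using fun_space.span_add[of f _ g] by (simp add: plus_fun_def)

lemma box_span_mult:
  assumes "f \<in> box_span J e" "g \<in> box_span J e'"
  shows "(\<lambda>x. f x * g x) \<in> box_span J (e + e')"
  using assms(1)
proof (induction rule: fun_space.span_induct_alt)
  case base
  show ?case using fun_space.span_zero by (simp add: zero_fun_def)
next
  case (step c f f')
  have "(\<lambda>x. f x * g x) \<in> box_span J (e + e')"
    using assms(2)
  proof (induction rule: fun_space.span_induct_alt)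
    case base
    show ?case using fun_space.span_zero by (simp add: zero_fun_def)
  next
    case (step d h h')
    have "(\<lambda>x. d * (f x * h x)) \<in> box_span J (e + e')"
      using fun_space.span_scale[OF fun_space.span_base[OF box_monomials_mult[OF \<open>f \<in> _\<close> step(1)]], of d] .
    from box_span_add[OF this step(2)] show ?case by (simp add: algebra_simps)
  qed
  hence "(\<lambda>x. c * (f x * g x)) \<in> box_span J (e + e')" by (rule fun_space.span_scale)
  from box_span_add[OF this step(2)] show ?case by (simp add: algebra_simps)
qed

lemma box_span_const:
  assumes "finite J" shows "(\<lambda>_. c) \<in> box_span J e"
proof -
  have "(\<lambda>_. 1) \<in> box_monomials J e"
    unfolding box_monomials_def by (intro image_eqI[of _ _ "restrict (\<lambda>_. 0) J"]) auto
  from fun_space.span_scale[OF fun_space.span_base[OF this], of c] show ?thesis by simp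
qed

lemma box_span_power:
  assumes "finite J" "f \<in> box_span J e" shows "(\<lambda>x. f x ^ k) \<in> box_span J (k * e)"
  by (induction k) (use assms in \<open>auto intro: box_span_const box_span_mult\<close>)

lemma box_span_prod:
  assumes "finite J" "finite A" "\<And>a. a \<in> A \<Longrightarrow> f a \<in> box_span J (e a)"
  shows "(\<lambda>x. \<Prod>a\<in>A. f a x) \<in> box_span J (\<Sum>a\<in>A. e a)"
  using assms(2,3) by (induction A rule: finite_induct) (auto intro: box_span_const[OF assms(1)] box_span_mult)

lemma polyfun_in_box_span:
  assumes "finite J" "polyfun J f" shows "\<exists>e. f \<in> box_span J e"
  using assms(2)
proof induction
  case (const c)
  show ?case using box_span_const[OF assms(1)] by blast
next
  case (var i)
  have "(\<Prod>j\<in>J. x j ^ restrict (\<lambda>j. if j = i then 1 else 0) J j) = x i" for x :: "'a \<Rightarrow> 'b"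
  proof -
    have "(\<Prod>j\<in>J. x j ^ restrict (\<lambda>j. if j = i then 1 else 0) J j) = (\<Prod>j\<in>J. if j = i then x j else 1)"
      by (intro prod.cong) auto
    thus ?thesis using var assms(1) by simp
  qed
  hence "(\<lambda>x. x i) \<in> (box_monomials J 1 :: (('a \<Rightarrow> 'b) \<Rightarrow> 'b) set)"
    unfolding box_monomials_def
    by (intro image_eqI[of _ _ "restrict (\<lambda>j. if j = i then 1 else 0) J"]) (auto simp: fun_eq_iff)
  thus ?case using fun_space.span_base by blast
next
  case (add f g)
  then obtain e e' where "f \<in> box_span J e" "g \<in> box_span J e'" by blast
  hence "f \<in> box_span J (e + e')" "g \<in> box_span J (e + e')" by (auto elim: box_span_mono)
  thus ?case using box_span_add by blast
next
  case (mult f g)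
  thus ?case using box_span_mult by blast
qed

text \<open>
  There are \<open>D ^ r\<close> monomials in \<open>r\<close> given functions with exponents below \<open>D\<close>, and they lie in a space
  whose dimension is only of the order of \<open>D ^ card J\<close>.
\<close>

lemma chain_length_bound:
  fixes C :: "nat \<Rightarrow> ('v \<Rightarrow> 'k::field) set"
  assumes J: "finite J"
    and C: "\<And>i. i \<le> r \<Longrightarrow> irred_on J (C i)" "\<And>i. i < r \<Longrightarrow> C i \<subseteq> C (Suc i)"
    and g: "\<And>i. i < r \<Longrightarrow> polyfun J (g i)" "\<And>i x. i < r \<Longrightarrow> x \<in> C i \<Longrightarrow> g i x = 0"
      "\<And>i. i < r \<Longrightarrow> \<exists>x\<in>C (Suc i). g i x \<noteq> 0"
  shows "r \<le> card J"
proof (rule ccontr)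
  assume r: "\<not> r \<le> card J"
  obtain e where e: "\<And>i. i < r \<Longrightarrow> g i \<in> box_span J (e i)"
    using polyfun_in_box_span[OF J g(1)] by metis
  define E where "E = (\<Sum>i<r. e i)"
  define D where "D = Suc E ^ card J + 1"
  let ?A = "{..<r} \<rightarrow>\<^sub>E {..<D}"
  let ?v = "\<lambda>a x. \<Prod>i<r. g i x ^ a i"
  have "?v a \<in> box_span J (D * E)" if "a \<in> ?A" for a
  proof -
    have "?v a \<in> box_span J (\<Sum>i<r. a i * e i)"
      using e by (intro box_span_prod box_span_power J) auto
    moreover have "(\<Sum>i<r. a i * e i) \<le> D * E"
      unfolding E_def sum_distrib_left using that
      by (intro sum_mono mult_right_mono) (auto simp: PiE_iff less_imp_le)
    ultimately show ?thesis by (rule box_span_mono)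
  qed
  hence "?v ` ?A \<subseteq> box_span J (D * E)" by blast
  moreover have "card (box_monomials J (D * E) :: (('v \<Rightarrow> 'k) \<Rightarrow> 'k) set) < card ?A"
  proof -
    have "card (box_monomials J (D * E) :: (('v \<Rightarrow> 'k) \<Rightarrow> 'k) set) \<le> Suc (D * E) ^ card J"
      by (rule box_monomials_card(2)[OF J])
    also have "\<dots> \<le> (Suc E * D) ^ card J"
      by (intro power_mono) (auto simp: D_def)
    also have "\<dots> = Suc E ^ card J * D ^ card J" by (rule power_mult_distrib)
    also have "\<dots> < D * D ^ card J" by (simp add: D_def)
    also have "\<dots> = D ^ Suc (card J)" by simp
    also have "\<dots> \<le> D ^ r" using r by (intro power_increasing) (auto simp: D_def)
    also have "\<dots> = card ?A" by (simp add: card_funcsetE)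
    finally show ?thesis .
  qed
  moreover have "finite ?A" by (intro finite_PiE) auto
  ultimately have "\<exists>c. (\<exists>a\<in>?A. c a \<noteq> 0) \<and> (\<Sum>a\<in>?A. (\<lambda>x. c a * ?v a x)) = 0"
    by (intro fun_space.nontrivial_relation[OF _ box_monomials_card(1)[OF J]])
  then obtain c where c: "\<exists>a\<in>?A. c a \<noteq> 0" "(\<Sum>a\<in>?A. (\<lambda>x. c a * ?v a x)) = 0" by blast
  have sum_apply: "(\<Sum>a\<in>S. F a) x = (\<Sum>a\<in>S. F a x)" for S x and F :: "(nat \<Rightarrow> nat) \<Rightarrow> ('v \<Rightarrow> 'k) \<Rightarrow> 'k"
    by (induction S rule: infinite_finite_induct) auto
  have rel: "(\<Sum>a\<in>?A. c a * ?v a x) = 0" for x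
    using fun_cong[OF c(2), of x] by (simp add: sum_apply)
  have "c a = 0" if "a \<in> ?A" for a
    by (rule chain_monomials_independent[where r = r and J = J and C = C and g = g and c = c and D = D])
      (use C g rel that in auto)
  with c(1) show False by blast
qed

lemma irreducible_chain_bound:
  fixes Z :: "nat \<Rightarrow> 'k::alg_closed_field point set"
  assumes Z: "\<And>i. i \<le> r \<Longrightarrow> proj_closed n (Z i) \<and> proj_irreducible n (Z i)"
    and strict: "\<And>i. i < r \<Longrightarrow> Z i \<subset> Z (Suc i)"
  shows "r \<le> n + 1"
proof -
  have "\<exists>f. polyfun {..n} f \<and> (\<forall>x\<in>\<Union>(Z i). f x = 0) \<and> (\<exists>x\<in>\<Union>(Z (Suc i)). f x \<noteq> 0)" if i: "i < r" for i
  proof -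
    have cl: "proj_closed n (Z i)" "Z (Suc i) \<subseteq> proj_space n"
      using Z[of i] Z[of "Suc i"] i proj_closed_subset by auto
    obtain x where x: "x \<in> Z (Suc i)" "x \<notin> Z i" using strict[OF i] by blast
    hence xp: "x \<in> proj_space n" using cl by blast
    obtain d f where f: "formfun n d f" "\<And>v. v \<in> x \<Longrightarrow> f v \<noteq> 0" "\<And>y u. y \<in> Z i \<Longrightarrow> u \<in> y \<Longrightarrow> f u = 0"
      using proj_closed_separating_form[OF cl(1) xp x(2)] by blast
    obtain v where "v \<in> x" using proj_space_nonempty[OF xp] by blast
    with f x(1) formfun_polyfun[OF f(1)] show ?thesis by (intro exI[of _ f]) blast
  qed
  then obtain g where g: "\<And>i. i < r \<Longrightarrow> polyfun {..n} (g i) \<and> (\<forall>x\<in>\<Union>(Z i). g i x = 0) \<and>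
      (\<exists>x\<in>\<Union>(Z (Suc i)). g i x \<noteq> 0)" by metis
  have "r \<le> card {..n}"
  proof (rule chain_length_bound[where C = "\<lambda>i. \<Union>(Z i)" and g = g])
    show "irred_on {..n} (\<Union>(Z i))" if "i \<le> r" for i
      using Z[OF that] proj_closed_subset irred_on_cone by blast
    show "\<Union>(Z i) \<subseteq> \<Union>(Z (Suc i))" if "i < r" for i using strict[OF that] by blast
  qed (use g in auto)
  thus ?thesis by simp
qed

lemma maximal_irreducible_closed:
  fixes \<A> :: "'k::alg_closed_field point set set"
  assumes "\<A> \<noteq> {}" "\<And>A. A \<in> \<A> \<Longrightarrow> proj_closed n A \<and> proj_irreducible n A"
  shows "\<exists>A\<in>\<A>. \<forall>B\<in>\<A>. A \<subseteq> B \<longrightarrow> B = A"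
proof (rule ccontr)
  assume "\<not> ?thesis"
  hence step: "\<exists>B\<in>\<A>. A \<subset> B" if "A \<in> \<A>" for A using that by blast
  obtain A0 where "A0 \<in> \<A>" using assms(1) by blast
  then obtain Z where Z: "\<And>i::nat. Z i \<in> \<A>" "\<And>i. Z i \<subset> Z (Suc i)"
    using dependent_nat_choice[of "\<lambda>_ A. A \<in> \<A>" "\<lambda>_ A B. A \<subset> B"] step by metis
  have "n + 2 \<le> n + 1"
    by (rule irreducible_chain_bound[of _ n Z]) (use Z assms(2) in auto)
  thus False by simp
qed

section \<open>Locally polynomial maps\<close>

text \<open>
  Morphisms in coordinates. The functions \<open>\<phi>\<close> are not required to be homogeneous, so locally
  polynomial maps can be composed without any attention to degrees.
\<close>

definition locally_polynomial ::
  "'v set \<Rightarrow> ('v \<Rightarrow> 'k::field) set \<Rightarrow> (('v \<Rightarrow> 'k) \<Rightarrow> 'k point) \<Rightarrow> bool" where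
  "locally_polynomial J T \<Phi> \<longleftrightarrow>
     (\<forall>u\<in>T. \<exists>h \<phi>. polyfun J h \<and> (\<forall>i. polyfun J (\<lambda>u. \<phi> u i)) \<and> h u \<noteq> 0 \<and>
        (\<forall>u'\<in>T. h u' \<noteq> 0 \<longrightarrow> \<Phi> u' = point_of (\<phi> u')))"

lemma locally_polynomialE:
  assumes "locally_polynomial J T \<Phi>" "u \<in> T"
  obtains h \<phi> where "polyfun J h" "\<And>i. polyfun J (\<lambda>u. \<phi> u i)" "h u \<noteq> 0"
    "\<And>u'. u' \<in> T \<Longrightarrow> h u' \<noteq> 0 \<Longrightarrow> \<Phi> u' = point_of (\<phi> u')"
proof -
  from bspec[OF assms(1)[unfolded locally_polynomial_def] assms(2)] obtain h \<phi> where
    *: "polyfun J h" "\<forall>i. polyfun J (\<lambda>u. \<phi> u i)" "h u \<noteq> 0"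
      "\<forall>u'\<in>T. h u' \<noteq> 0 \<longrightarrow> \<Phi> u' = point_of (\<phi> u')"
    by (elim exE conjE)
  show thesis by (rule that[of h \<phi>]) (use * in simp_all)
qed

lemma locally_polynomial_const:
  fixes x :: "'k::field point"
  assumes "x \<in> proj_space n" shows "locally_polynomial J T (\<lambda>_. x)"
proof -
  obtain v where "v \<in> x" using proj_space_nonempty assms by blast
  thus ?thesis
    unfolding locally_polynomial_def using proj_space_coords(1)[OF assms]
    by (intro ballI exI[of _ "\<lambda>_. 1 :: 'k"] exI[of _ "\<lambda>_. v"]) (auto intro: polyfun.const)
qed

lemma locally_polynomial_point_of:
  fixes T :: "(nat \<Rightarrow> 'a::field) set"
  assumes "T \<subseteq> coord_space n" shows "locally_polynomial {..n} T point_of"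
  unfolding locally_polynomial_def
proof (intro ballI exI[of _ "\<lambda>_. 1 :: 'a"] exI[of _ "\<lambda>u i. if i \<le> n then u i else 0"] conjI allI impI)
  show "polyfun {..n} (\<lambda>u :: nat \<Rightarrow> 'a. if i \<le> n then u i else 0)" for i
    by (cases "i \<le> n") (auto intro: polyfun.intros)
  show "point_of u = point_of (\<lambda>i. if i \<le> n then u i else 0)" if "u \<in> T" for u
    using that assms by (intro arg_cong[of _ _ point_of]) (auto simp: coord_space_def fun_eq_iff)
qed (auto intro: polyfun.const)

lemma locally_polynomial_subst:
  assumes \<Phi>: "locally_polynomial J T \<Phi>"
    and \<pi>: "\<And>w. w \<in> T' \<Longrightarrow> \<pi> w \<in> T" "\<And>i. i \<in> J \<Longrightarrow> polyfun K (\<lambda>w. \<pi> w i)"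
  shows "locally_polynomial K T' (\<lambda>w. \<Phi> (\<pi> w))"
  unfolding locally_polynomial_def
proof
  fix w assume w: "w \<in> T'"
  from locally_polynomialE[OF \<Phi> \<pi>(1)[OF w]] obtain h \<phi> where
    *: "polyfun J h" "\<And>i. polyfun J (\<lambda>u. \<phi> u i)" "h (\<pi> w) \<noteq> 0"
    "\<And>u'. u' \<in> T \<Longrightarrow> h u' \<noteq> 0 \<Longrightarrow> \<Phi> u' = point_of (\<phi> u')" by metis
  show "\<exists>h \<phi>. polyfun K h \<and> (\<forall>i. polyfun K (\<lambda>u. \<phi> u i)) \<and> h w \<noteq> 0 \<and>
      (\<forall>w'\<in>T'. h w' \<noteq> 0 \<longrightarrow> \<Phi> (\<pi> w') = point_of (\<phi> w'))"
  proof (intro exI[of _ "\<lambda>w. h (\<pi> w)"] exI[of _ "\<lambda>w. \<phi> (\<pi> w)"] conjI allI ballI impI)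
    show "polyfun K (\<lambda>w. h (\<pi> w))" by (rule polyfun_subst[OF *(1) \<pi>(2)])
    show "polyfun K (\<lambda>w. \<phi> (\<pi> w) i)" for i by (rule polyfun_subst[OF *(2) \<pi>(2)])
  qed (use * \<pi>(1) in auto)
qed

lemma locally_polynomial_morphism:
  assumes f: "morphism n X m Y f" and \<Phi>: "locally_polynomial J T \<Phi>" "\<And>u. u \<in> T \<Longrightarrow> \<Phi> u \<in> X"
  shows "locally_polynomial J T (\<lambda>u. f (\<Phi> u))"
  unfolding locally_polynomial_def
proof
  fix u assume u: "u \<in> T"
  from locally_polynomialE[OF \<Phi>(1) u] obtain h \<phi> where
    *: "polyfun J h" "\<And>i. polyfun J (\<lambda>u. \<phi> u i)" "h u \<noteq> 0"
    "\<And>u'. u' \<in> T \<Longrightarrow> h u' \<noteq> 0 \<Longrightarrow> \<Phi> u' = point_of (\<phi> u')" by metis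
  from bspec[OF conjunct2[OF f[unfolded morphism_def]] \<Phi>(2)[OF u]]
  obtain F where F: "\<forall>v\<in>\<Phi> u. \<exists>j\<le>m. eval (F j) v \<noteq> 0"
    "\<forall>y\<in>X. \<forall>v\<in>y. (\<exists>j\<le>m. eval (F j) v \<noteq> 0) \<longrightarrow>
       f y = point_of (\<lambda>j. if j \<le> m then eval (F j) v else 0)"
    by (elim exE conjE)
  have "\<phi> u \<in> \<Phi> u" using *(4)[OF u *(3)] by simp
  then obtain j where j: "j \<le> m" "eval (F j) (\<phi> u) \<noteq> 0" using F(1) by blast
  have poly: "polyfun J (\<lambda>u. eval (F i) (\<phi> u))" for i by (rule polyfun_eval[of UNIV]) (auto intro: *)
  show "\<exists>h \<phi>. polyfun J h \<and> (\<forall>i. polyfun J (\<lambda>u. \<phi> u i)) \<and> h u \<noteq> 0 \<and>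
      (\<forall>u'\<in>T. h u' \<noteq> 0 \<longrightarrow> f (\<Phi> u') = point_of (\<phi> u'))"
  proof (intro exI[of _ "\<lambda>u. h u * eval (F j) (\<phi> u)"]
      exI[of _ "\<lambda>u i. if i \<le> m then eval (F i) (\<phi> u) else 0"] conjI allI ballI impI)
    show "polyfun J (\<lambda>u. h u * eval (F j) (\<phi> u))" by (intro polyfun.mult * poly)
    show "polyfun J (\<lambda>u. if i \<le> m then eval (F i) (\<phi> u) else 0)" for i
      by (cases "i \<le> m") (auto intro: poly polyfun.const)
    fix u' assume u': "u' \<in> T" "h u' * eval (F j) (\<phi> u') \<noteq> 0"
    hence "\<phi> u' \<in> \<Phi> u'" using *(4) by simp
    thus "f (\<Phi> u') = point_of (\<lambda>i. if i \<le> m then eval (F i) (\<phi> u') else 0)"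
      using u' j(1) \<Phi>(2) by (intro F(2)[rule_format, of _ "\<phi> u'"]) auto
  qed (use * j in auto)
qed

lemma locally_polynomial_morphism2:
  assumes f: "morphism2 n X n' X' m Y f"
    and \<Phi>: "locally_polynomial J T \<Phi>" "\<And>u. u \<in> T \<Longrightarrow> \<Phi> u \<in> X"
    and \<Psi>: "locally_polynomial J T \<Psi>" "\<And>u. u \<in> T \<Longrightarrow> \<Psi> u \<in> X'"
  shows "locally_polynomial J T (\<lambda>u. f (\<Phi> u) (\<Psi> u))"
  unfolding locally_polynomial_def
proof
  fix u assume u: "u \<in> T"
  from locally_polynomialE[OF \<Phi>(1) u] obtain h \<phi> where
    *: "polyfun J h" "\<And>i. polyfun J (\<lambda>u. \<phi> u i)" "h u \<noteq> 0"
    "\<And>u'. u' \<in> T \<Longrightarrow> h u' \<noteq> 0 \<Longrightarrow> \<Phi> u' = point_of (\<phi> u')" by metis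
  from locally_polynomialE[OF \<Psi>(1) u] obtain g \<psi> where
    **: "polyfun J g" "\<And>i. polyfun J (\<lambda>u. \<psi> u i)" "g u \<noteq> 0"
    "\<And>u'. u' \<in> T \<Longrightarrow> g u' \<noteq> 0 \<Longrightarrow> \<Psi> u' = point_of (\<psi> u')" by metis
  let ?e = "\<lambda>F u. eval F (case_sum (\<phi> u) (\<psi> u))"
  from bspec[OF bspec[OF conjunct2[OF f[unfolded morphism2_def]] \<Phi>(2)[OF u]] \<Psi>(2)[OF u]]
  obtain F where F: "\<forall>v\<in>\<Phi> u. \<forall>v'\<in>\<Psi> u. \<exists>j\<le>m. eval (F j) (case_sum v v') \<noteq> 0"
    "\<forall>y\<in>X. \<forall>y'\<in>X'. \<forall>v\<in>y. \<forall>v'\<in>y'. (\<exists>j\<le>m. eval (F j) (case_sum v v') \<noteq> 0) \<longrightarrow>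
       f y y' = point_of (\<lambda>j. if j \<le> m then eval (F j) (case_sum v v') else 0)"
    by (elim exE conjE)
  have "\<phi> u \<in> \<Phi> u" "\<psi> u \<in> \<Psi> u" using *(4)[OF u *(3)] **(4)[OF u **(3)] by simp_all
  then obtain j where j: "j \<le> m" "?e (F j) u \<noteq> 0" using F(1) by blast
  have poly: "polyfun J (\<lambda>u. ?e (F i) u)" for i
  proof (rule polyfun_eval[of UNIV])
    show "polyfun J (\<lambda>u. case_sum (\<phi> u) (\<psi> u) k)" for k by (cases k) (auto intro: * **)
  qed auto
  show "\<exists>h \<phi>. polyfun J h \<and> (\<forall>i. polyfun J (\<lambda>u. \<phi> u i)) \<and> h u \<noteq> 0 \<and>
      (\<forall>u'\<in>T. h u' \<noteq> 0 \<longrightarrow> f (\<Phi> u') (\<Psi> u') = point_of (\<phi> u'))"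
  proof (intro exI[of _ "\<lambda>u. h u * g u * ?e (F j) u"]
      exI[of _ "\<lambda>u i. if i \<le> m then ?e (F i) u else 0"] conjI allI ballI impI)
    show "polyfun J (\<lambda>u. h u * g u * ?e (F j) u)" by (intro polyfun.mult * ** poly)
    show "polyfun J (\<lambda>u. if i \<le> m then ?e (F i) u else 0)" for i
      by (cases "i \<le> m") (auto intro: poly polyfun.const)
    fix u' assume u': "u' \<in> T" "h u' * g u' * ?e (F j) u' \<noteq> 0"
    hence "\<phi> u' \<in> \<Phi> u'" "\<psi> u' \<in> \<Psi> u'" using *(4) **(4) by simp_all
    thus "f (\<Phi> u') (\<Psi> u') = point_of (\<lambda>i. if i \<le> m then ?e (F i) u' else 0)"
      using u' j(1) \<Phi>(2) \<Psi>(2) by (intro F(2)[rule_format, of _ _ "\<phi> u'" "\<psi> u'"]) auto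
  qed (use * ** j in auto)
qed

lemma proj_closed_preimage:
  fixes X :: "'k::alg_closed_field point set"
  assumes X: "proj_closed n X" and C: "proj_closed m C"
    and \<Psi>: "locally_polynomial {..n} (\<Union>X) \<Psi>" "\<And>v. v \<in> \<Union>X \<Longrightarrow> \<Psi> v \<in> proj_space m"
  shows "proj_closed n {x \<in> X. \<forall>v\<in>x. \<Psi> v \<in> C}"
proof (rule proj_closedI)
  show "{x \<in> X. \<forall>v\<in>x. \<Psi> v \<in> C} \<subseteq> proj_space n" using proj_closed_subset[OF X] by blast
  fix x assume x: "x \<in> proj_space n" "x \<notin> {x \<in> X. \<forall>v\<in>x. \<Psi> v \<in> C}"
  show "\<exists>p. polyfun {..n} p \<and> (\<exists>v\<in>x. p v \<noteq> 0) \<and> (\<forall>y\<in>{x \<in> X. \<forall>v\<in>x. \<Psi> v \<in> C}. \<forall>u\<in>y. p u = 0)"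
  proof (cases "x \<in> X")
    case False
    obtain d f where f: "formfun n d f" "\<And>v. v \<in> x \<Longrightarrow> f v \<noteq> 0" "\<And>y u. y \<in> X \<Longrightarrow> u \<in> y \<Longrightarrow> f u = 0"
      using proj_closed_separating_form[OF X x(1) False] by blast
    obtain v where "v \<in> x" using proj_space_nonempty x(1) by blast
    with f formfun_polyfun[OF f(1)] show ?thesis by (intro exI[of _ f]) blast
  next
    case True
    with x(2) obtain v where v: "v \<in> x" "\<Psi> v \<notin> C" by blast
    have vX: "v \<in> \<Union>X" using v(1) True by blast
    from locally_polynomialE[OF \<Psi>(1) vX] obtain h \<phi> where
      *: "polyfun {..n} h" "\<And>i. polyfun {..n} (\<lambda>u. \<phi> u i)" "h v \<noteq> 0"
      "\<And>u'. u' \<in> \<Union>X \<Longrightarrow> h u' \<noteq> 0 \<Longrightarrow> \<Psi> u' = point_of (\<phi> u')" by metis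
    obtain d f where f: "formfun m d f" "\<And>w. w \<in> \<Psi> v \<Longrightarrow> f w \<noteq> 0" "\<And>y u. y \<in> C \<Longrightarrow> u \<in> y \<Longrightarrow> f u = 0"
      using proj_closed_separating_form[OF C \<Psi>(2)[OF vX] v(2)] by blast
    have "polyfun {..n} (\<lambda>u. h u * f (\<phi> u))"
      by (intro polyfun.mult * polyfun_subst[OF formfun_polyfun[OF f(1)]])
    moreover have "h v * f (\<phi> v) \<noteq> 0" using *(3) *(4)[OF vX *(3)] f(2) by simp
    moreover have "h u * f (\<phi> u) = 0" if "y \<in> X" "\<forall>v\<in>y. \<Psi> v \<in> C" "u \<in> y" for y u
    proof (cases "h u = 0")
      case False
      hence "\<Psi> u = point_of (\<phi> u)" using *(4) that by blast
      hence "\<phi> u \<in> \<Psi> u" by simp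
      moreover have "\<Psi> u \<in> C" using that by blast
      ultimately show ?thesis using f(3) by simp
    qed simp
    ultimately show ?thesis using v(1) by (intro exI[of _ "\<lambda>u. h u * f (\<phi> u)"]) blast
  qed
qed

section \<open>Parametrized subsets of projective space\<close>

text \<open>
  The domain \<open>T\<close> is irreducible and open in its closure, by the fourth condition. Its vectors are
  supported on the finite set \<open>J\<close>, so it is determined by finitely many coordinates.
\<close>

definition parametrization ::
  "nat \<Rightarrow> nat set \<Rightarrow> (nat \<Rightarrow> 'k::field) set \<Rightarrow> ((nat \<Rightarrow> 'k) \<Rightarrow> 'k point) \<Rightarrow> bool" where
  "parametrization n J T \<Phi> \<longleftrightarrow>
     finite J \<and> irred_on J T \<and> (\<forall>u\<in>T. \<forall>i. i \<notin> J \<longrightarrow> u i = 0) \<and>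
     (\<forall>u\<in>T. \<exists>h. polyfun J h \<and> h u \<noteq> 0 \<and>
        (\<forall>u'. (\<forall>i. i \<notin> J \<longrightarrow> u' i = 0) \<longrightarrow> in_closure J T u' \<longrightarrow> h u' \<noteq> 0 \<longrightarrow> u' \<in> T)) \<and>
     locally_polynomial J T \<Phi> \<and> \<Phi> ` T \<subseteq> proj_space n"

definition parametrized :: "nat \<Rightarrow> 'k::field point set \<Rightarrow> bool" where
  "parametrized n X \<longleftrightarrow> (\<exists>J T \<Phi>. parametrization n J T \<Phi> \<and> \<Phi> ` T = X)"

lemma parametrizedE:
  fixes X :: "'k::field point set"
  assumes "parametrized n X"
  obtains J :: "nat set" and T \<Phi> where "finite J" "irred_on J T" "\<forall>u\<in>T. \<forall>i. i \<notin> J \<longrightarrow> u i = 0"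
    "\<forall>u\<in>T. \<exists>h. polyfun J h \<and> h u \<noteq> 0 \<and>
        (\<forall>u'. (\<forall>i. i \<notin> J \<longrightarrow> u' i = 0) \<longrightarrow> in_closure J T u' \<longrightarrow> h u' \<noteq> 0 \<longrightarrow> u' \<in> T)"
    "locally_polynomial J T \<Phi>" "X = \<Phi> ` T"
proof -
  obtain J T \<Phi> where P: "parametrization n J T \<Phi>" "X = \<Phi> ` T"
    using assms unfolding parametrized_def by blast
  from P(1)[unfolded parametrization_def] show thesis
    by (elim conjE) (rule that[OF _ _ _ _ _ P(2)])
qed

lemma parametrized_subset: "parametrized n X \<Longrightarrow> X \<subseteq> proj_space n"
  by (auto simp: parametrized_def parametrization_def)

lemma parametrized_singleton:
  assumes "x \<in> proj_space n" shows "parametrized n {x :: 'k::field point}"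
  unfolding parametrized_def
proof (intro exI conjI)
  have "irred_on {} {\<lambda>_. 0 :: 'k}" by (auto simp: irred_on_def)
  thus "parametrization n {} {\<lambda>_. 0} (\<lambda>_. x)"
    using assms unfolding parametrization_def
    by (auto intro!: exI[of _ "\<lambda>_. 1"] polyfun.const locally_polynomial_const[OF assms])
qed auto

lemma parametrized_irreducible:
  fixes X :: "'k::field point set"
  assumes "parametrized n X"
  shows "proj_irreducible n X"
  unfolding proj_irreducible_def
proof (intro conjI allI impI)
  obtain J :: "nat set" and T \<Phi> where P0: "irred_on J T" "locally_polynomial J T \<Phi>" "X = \<Phi> ` T"
    by (rule parametrizedE[OF assms]) (rule that)
  note P = P0 parametrized_subset[OF assms, unfolded P0(3)]
  show "X \<noteq> {}" using P unfolding irred_on_def by blast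
  have key: "\<exists>p. polyfun J p \<and> (\<exists>u\<in>T. p u \<noteq> 0) \<and> (\<forall>u\<in>T. \<Phi> u \<in> A \<longrightarrow> p u = 0)"
    if A: "proj_closed n A" "\<not> X \<subseteq> A" for A
  proof -
    obtain u where u: "u \<in> T" "\<Phi> u \<notin> A" using A(2) P(3) by blast
    from locally_polynomialE[OF P(2) u(1)] obtain h \<phi> where
      *: "polyfun J h" "\<And>i. polyfun J (\<lambda>u. \<phi> u i)" "h u \<noteq> 0"
      "\<And>u'. u' \<in> T \<Longrightarrow> h u' \<noteq> 0 \<Longrightarrow> \<Phi> u' = point_of (\<phi> u')" by metis
    have "\<Phi> u \<in> proj_space n" using P(4) u(1) by blast
    from proj_closed_separating_form[OF A(1) this u(2)] obtain d f where
      f: "formfun n d f" "\<And>v. v \<in> \<Phi> u \<Longrightarrow> f v \<noteq> 0" "\<And>y u. y \<in> A \<Longrightarrow> u \<in> y \<Longrightarrow> f u = 0" by metis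
    have "polyfun J (\<lambda>u. h u * f (\<phi> u))"
      by (intro polyfun.mult * polyfun_subst[OF formfun_polyfun[OF f(1)]])
    moreover have "h u * f (\<phi> u) \<noteq> 0" using *(3) *(4)[OF u(1) *(3)] f(2) by simp
    moreover have "h u' * f (\<phi> u') = 0" if "u' \<in> T" "\<Phi> u' \<in> A" for u'
    proof (cases "h u' = 0")
      case False
      hence "\<Phi> u' = point_of (\<phi> u')" using *(4) that by blast
      hence "\<phi> u' \<in> \<Phi> u'" by simp
      thus ?thesis using f(3) that by simp
    qed simp
    ultimately show ?thesis using u(1) by (intro exI[of _ "\<lambda>u. h u * f (\<phi> u)"]) blast
  qed
  fix A B assume AB: "proj_closed n A" "proj_closed n B" "X \<subseteq> A \<union> B"
  show "X \<subseteq> A \<or> X \<subseteq> B"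
  proof (rule ccontr)
    assume "\<not> ?thesis"
    hence nsub: "\<not> X \<subseteq> A" "\<not> X \<subseteq> B" by auto
    from key[OF AB(1) nsub(1)] obtain p
      where p: "polyfun J p" "\<exists>u\<in>T. p u \<noteq> 0" "\<forall>u\<in>T. \<Phi> u \<in> A \<longrightarrow> p u = 0"
      by (elim exE conjE)
    from key[OF AB(2) nsub(2)] obtain q
      where q: "polyfun J q" "\<exists>u\<in>T. q u \<noteq> 0" "\<forall>u\<in>T. \<Phi> u \<in> B \<longrightarrow> q u = 0"
      by (elim exE conjE)
    obtain u where "u \<in> T" "p u \<noteq> 0" "q u \<noteq> 0" using irred_onD[OF P(1) p(1) q(1) p(2) q(2)] by blast
    moreover from this have "\<Phi> u \<in> A \<union> B" using AB(3) P(3) by blast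
    ultimately show False using p(3) q(3) by blast
  qed
qed

text \<open>All parametrizations have their domain in one type, so a pair of parameters has to be a vector again.\<close>

definition interleave :: "(nat \<Rightarrow> 'k) \<Rightarrow> (nat \<Rightarrow> 'k) \<Rightarrow> nat \<Rightarrow> 'k" where
  "interleave u u' k = (if even k then u (k div 2) else u' (k div 2))"

text \<open>
  The product of the two domains is irreducible: two functions that do not vanish identically on it
  are made nonzero at a common point by choosing the first component and then the second.
\<close>

lemma parametrized_morphism2_image:
  fixes X X' :: "'k::field point set"
  assumes f: "morphism2 n Y n' Y' m W f" and W: "W \<subseteq> proj_space m"
    and X: "parametrized n X" "X \<subseteq> Y" and X': "parametrized n' X'" "X' \<subseteq> Y'"
  shows "parametrized m {f x x' |x x'. x \<in> X \<and> x' \<in> X'}"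
proof -
  obtain J :: "nat set" and T \<Phi> where P0: "finite J" "irred_on J T" "\<forall>u\<in>T. \<forall>i. i \<notin> J \<longrightarrow> u i = 0"
    "\<forall>u\<in>T. \<exists>h. polyfun J h \<and> h u \<noteq> 0 \<and>
        (\<forall>u'. (\<forall>i. i \<notin> J \<longrightarrow> u' i = 0) \<longrightarrow> in_closure J T u' \<longrightarrow> h u' \<noteq> 0 \<longrightarrow> u' \<in> T)"
    "locally_polynomial J T \<Phi>" "X = \<Phi> ` T"
    by (rule parametrizedE[OF X(1)]) (rule that)
  note P = P0[rule_format]
  obtain J' :: "nat set" and T' \<Phi>' where P0': "finite J'" "irred_on J' T'" "\<forall>u\<in>T'. \<forall>i. i \<notin> J' \<longrightarrow> u i = 0"
    "\<forall>u\<in>T'. \<exists>h. polyfun J' h \<and> h u \<noteq> 0 \<and>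
        (\<forall>u'. (\<forall>i. i \<notin> J' \<longrightarrow> u' i = 0) \<longrightarrow> in_closure J' T' u' \<longrightarrow> h u' \<noteq> 0 \<longrightarrow> u' \<in> T')"
    "locally_polynomial J' T' \<Phi>'" "X' = \<Phi>' ` T'"
    by (rule parametrizedE[OF X'(1)]) (rule that)
  note P' = P0'[rule_format]
  define K where "K = (\<lambda>i. 2 * i) ` J \<union> (\<lambda>i. 2 * i + 1) ` J'"
  define \<pi> where "\<pi> = (\<lambda>(w :: nat \<Rightarrow> 'k) i. w (2 * i))"
  define \<pi>' where "\<pi>' = (\<lambda>(w :: nat \<Rightarrow> 'k) i. w (2 * i + 1))"
  define S where "S = {w. (\<forall>k. k \<notin> K \<longrightarrow> w k = 0) \<and> \<pi> w \<in> T \<and> \<pi>' w \<in> T'}"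
  have proj_interleave [simp]: "\<pi> (interleave u u') = u" "\<pi>' (interleave u u') = u'"
    for u u' by (auto simp: \<pi>_def \<pi>'_def interleave_def)
  have interleave_proj [simp]: "interleave (\<pi> w) (\<pi>' w) = w" for w
    by (auto simp: \<pi>_def \<pi>'_def interleave_def fun_eq_iff)
  have K_iff: "k \<in> K \<longleftrightarrow> (if even k then k div 2 \<in> J else k div 2 \<in> J')" for k
    by (auto simp: K_def image_iff elim!: evenE oddE) presburger+
  have interleave_S: "interleave u u' \<in> S" if "u \<in> T" "u' \<in> T'" for u u'
  proof -
    have "interleave u u' k = 0" if "k \<notin> K" for k
      using that \<open>u \<in> T\<close> \<open>u' \<in> T'\<close> P(3) P'(3) by (auto simp: K_iff interleave_def split: if_splits)
    thus ?thesis using that by (simp add: S_def)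
  qed
  have \<pi>poly: "polyfun K (\<lambda>w. \<pi> w i)" if "i \<in> J" for i
    using that by (auto simp: \<pi>_def K_def intro: polyfun.var)
  have \<pi>'poly: "polyfun K (\<lambda>w. \<pi>' w i)" if "i \<in> J'" for i
    using that by (auto simp: \<pi>'_def K_def intro: polyfun.var)
  have section1: "polyfun J (\<lambda>u. p (interleave u u'))" if "polyfun K p" for p u'
    using that
  proof (rule polyfun_subst)
    fix k assume "k \<in> K"
    thus "polyfun J (\<lambda>u. interleave u u' k)"
      by (cases "even k") (auto simp: interleave_def K_iff intro: polyfun.intros)
  qed
  have section2: "polyfun J' (\<lambda>u'. p (interleave u u'))" if "polyfun K p" for p u
    using that
  proof (rule polyfun_subst)
    fix k assume "k \<in> K"
    thus "polyfun J' (\<lambda>u'. interleave u u' k)"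
      by (cases "even k") (auto simp: interleave_def K_iff intro: polyfun.intros)
  qed
  have "irred_on K S"
    unfolding irred_on_def
  proof (intro conjI allI impI)
    show "S \<noteq> {}" using P(2) P'(2) interleave_S unfolding irred_on_def by blast
    fix p q assume p: "polyfun K p" "\<exists>z\<in>S. p z \<noteq> 0" and q: "polyfun K q" "\<exists>z\<in>S. q z \<noteq> 0"
    obtain z where z: "z \<in> S" "p z \<noteq> 0" using p(2) by blast
    obtain y where y: "y \<in> S" "q y \<noteq> 0" using q(2) by blast
    have "\<exists>u\<in>T. p (interleave u (\<pi>' z)) \<noteq> 0 \<and> q (interleave u (\<pi>' y)) \<noteq> 0"
    proof (rule irred_onD[OF P(2) section1[OF p(1)] section1[OF q(1)]])
      show "\<exists>u\<in>T. p (interleave u (\<pi>' z)) \<noteq> 0"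
        using z by (intro bexI[of _ "\<pi> z"]) (auto simp: S_def)
      show "\<exists>u\<in>T. q (interleave u (\<pi>' y)) \<noteq> 0"
        using y by (intro bexI[of _ "\<pi> y"]) (auto simp: S_def)
    qed
    then obtain u where u: "u \<in> T" "p (interleave u (\<pi>' z)) \<noteq> 0" "q (interleave u (\<pi>' y)) \<noteq> 0" by blast
    have "\<pi>' z \<in> T'" "\<pi>' y \<in> T'" using y z by (auto simp: S_def)
    with u have "\<exists>u'\<in>T'. p (interleave u u') \<noteq> 0 \<and> q (interleave u u') \<noteq> 0"
      by (intro irred_onD[OF P'(2) section2[OF p(1)] section2[OF q(1)]]) blast+
    thus "\<exists>z\<in>S. p z \<noteq> 0 \<and> q z \<noteq> 0" using interleave_S[OF u(1)] by blast
  qed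
  moreover have "\<exists>h. polyfun K h \<and> h w \<noteq> 0 \<and>
      (\<forall>w'. (\<forall>k. k \<notin> K \<longrightarrow> w' k = 0) \<longrightarrow> in_closure K S w' \<longrightarrow> h w' \<noteq> 0 \<longrightarrow> w' \<in> S)" if w: "w \<in> S" for w
  proof -
    have "\<pi> w \<in> T" "\<pi>' w \<in> T'" using w by (auto simp: S_def)
    then obtain h h' where h: "polyfun J h" "h (\<pi> w) \<noteq> 0" "\<And>u'. \<forall>i. i \<notin> J \<longrightarrow> u' i = 0 \<Longrightarrow>
          in_closure J T u' \<Longrightarrow> h u' \<noteq> 0 \<Longrightarrow> u' \<in> T"
      and h': "polyfun J' h'" "h' (\<pi>' w) \<noteq> 0" "\<And>u'. \<forall>i. i \<notin> J' \<longrightarrow> u' i = 0 \<Longrightarrow>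
          in_closure J' T' u' \<Longrightarrow> h' u' \<noteq> 0 \<Longrightarrow> u' \<in> T'"
      using P(4)[of "\<pi> w"] P'(4)[of "\<pi>' w"] by metis
    show ?thesis
    proof (intro exI[of _ "\<lambda>w. h (\<pi> w) * h' (\<pi>' w)"] conjI allI impI)
      show "polyfun K (\<lambda>w. h (\<pi> w) * h' (\<pi>' w))"
        by (intro polyfun.mult polyfun_subst[OF h(1) \<pi>poly] polyfun_subst[OF h'(1) \<pi>'poly])
      show "h (\<pi> w) * h' (\<pi>' w) \<noteq> 0" using h h' by simp
      fix w' assume w': "\<forall>k. k \<notin> K \<longrightarrow> w' k = 0" "in_closure K S w'" "h (\<pi> w') * h' (\<pi>' w') \<noteq> 0"
      have "\<pi> w' \<in> T"
      proof (rule h(3))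
        show "\<forall>i. i \<notin> J \<longrightarrow> \<pi> w' i = 0" using w'(1) by (auto simp: \<pi>_def K_iff)
        show "in_closure J T (\<pi> w')"
          by (rule in_closure_image[OF w'(2) _ \<pi>poly]) (simp_all add: S_def)
      qed (use w' in auto)
      moreover have "\<pi>' w' \<in> T'"
      proof (rule h'(3))
        show "\<forall>i. i \<notin> J' \<longrightarrow> \<pi>' w' i = 0" using w'(1) by (auto simp: \<pi>'_def K_iff)
        show "in_closure J' T' (\<pi>' w')"
          by (rule in_closure_image[OF w'(2) _ \<pi>'poly]) (simp_all add: S_def)
      qed (use w' in auto)
      ultimately show "w' \<in> S" using w'(1) by (simp add: S_def)
    qed
  qed
  moreover have "locally_polynomial K S (\<lambda>w. f (\<Phi> (\<pi> w)) (\<Phi>' (\<pi>' w)))"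
  proof (rule locally_polynomial_morphism2[OF f])
    show "locally_polynomial K S (\<lambda>w. \<Phi> (\<pi> w))"
      by (rule locally_polynomial_subst[OF P(5) _ \<pi>poly]) (auto simp: S_def)
    show "locally_polynomial K S (\<lambda>w. \<Phi>' (\<pi>' w))"
      by (rule locally_polynomial_subst[OF P'(5) _ \<pi>'poly]) (auto simp: S_def)
  qed (use X(2) X'(2) P(6) P'(6) in \<open>auto simp: S_def\<close>)
  moreover have image: "(\<lambda>w. f (\<Phi> (\<pi> w)) (\<Phi>' (\<pi>' w))) ` S = {f x x' |x x'. x \<in> X \<and> x' \<in> X'}"
  proof (intro equalityI subsetI)
    fix y assume "y \<in> {f x x' |x x'. x \<in> X \<and> x' \<in> X'}"
    then obtain u u' where u: "u \<in> T" "u' \<in> T'" "y = f (\<Phi> u) (\<Phi>' u')" using P(6) P'(6) by blast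
    thus "y \<in> (\<lambda>w. f (\<Phi> (\<pi> w)) (\<Phi>' (\<pi>' w))) ` S"
      by (intro image_eqI[OF _ interleave_S[OF u(1,2)]]) simp
  qed (use P(6) P'(6) in \<open>auto simp: S_def\<close>)
  moreover have "{f x x' |x x'. x \<in> X \<and> x' \<in> X'} \<subseteq> proj_space m"
    using conjunct1[OF f[unfolded morphism2_def]] X(2) X'(2) W by blast
  moreover have "finite K" using P(1) P'(1) by (simp add: K_def)
  moreover have "\<forall>w\<in>S. \<forall>k. k \<notin> K \<longrightarrow> w k = 0" by (simp add: S_def)
  ultimately have "parametrization m K S (\<lambda>w. f (\<Phi> (\<pi> w)) (\<Phi>' (\<pi>' w)))"
    unfolding parametrization_def by (intro conjI) simp_all
  with image show ?thesis unfolding parametrized_def by blast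
qed

section \<open>A parametrized set contains an open subset of its closure\<close>

lemma polyfun_along_curve:
  assumes "polyfun K p" "\<And>i. i \<in> K \<Longrightarrow> \<exists>P. \<forall>s. \<sigma> s i = poly P s"
  shows "\<exists>P. \<forall>s. p (\<sigma> s) = poly P s"
  using assms(1)
proof induction
  case (const c)
  show ?case by (rule exI[of _ "[:c:]"]) simp
next
  case (var i)
  thus ?case by (rule assms(2))
next
  case (add f g)
  then obtain P Q where "\<forall>s. f (\<sigma> s) = poly P s" "\<forall>s. g (\<sigma> s) = poly Q s" by (elim exE)
  thus ?case by (intro exI[of _ "P + Q"]) simp
next
  case (mult f g)
  then obtain P Q where "\<forall>s. f (\<sigma> s) = poly P s" "\<forall>s. g (\<sigma> s) = poly Q s" by (elim exE)
  thus ?case by (intro exI[of _ "P * Q"]) simp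
qed

text \<open>
  The graph of a local formula for the parametrization, projected to the coordinates of the values,
  is handled by \<open>extend_point\<close>. Each local formula determines the closure of the whole parametrized
  set, because the domain is irreducible.
\<close>

lemma parametrized_contains_open:
  fixes X :: "'k::alg_closed_field point set"
  assumes X: "parametrized n X"
  shows "\<exists>C. proj_closed n C \<and> \<not> proj_closure n X \<subseteq> C \<and> proj_closure n X - C \<subseteq> X"
proof -
  obtain J :: "nat set" and T \<Phi> where P0: "finite J" "irred_on J T" "\<forall>u\<in>T. \<forall>i. i \<notin> J \<longrightarrow> u i = 0"
    "\<forall>u\<in>T. \<exists>h. polyfun J h \<and> h u \<noteq> 0 \<and>
        (\<forall>u'. (\<forall>i. i \<notin> J \<longrightarrow> u' i = 0) \<longrightarrow> in_closure J T u' \<longrightarrow> h u' \<noteq> 0 \<longrightarrow> u' \<in> T)"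
    "locally_polynomial J T \<Phi>" "X = \<Phi> ` T"
    by (rule parametrizedE[OF X]) (rule that)
  note P = P0[rule_format]
  have Xp: "X \<subseteq> proj_space n" by (rule parametrized_subset[OF X])
  have clp: "proj_closure n X \<subseteq> proj_space n"
    by (rule proj_closed_subset[OF proj_closed_closure[OF Xp]])
  obtain u0 where u0: "u0 \<in> T" using P(2) by (auto simp: irred_on_def)
  from locally_polynomialE[OF P(5) u0] obtain h1 \<phi> where
    h1: "polyfun J h1" "h1 u0 \<noteq> 0" and \<phi>: "\<And>i. polyfun J (\<lambda>u. \<phi> u i)"
    and \<Phi>: "\<And>u'. u' \<in> T \<Longrightarrow> h1 u' \<noteq> 0 \<Longrightarrow> \<Phi> u' = point_of (\<phi> u')" by metis
  from P(4)[OF u0] obtain h2 where h2: "polyfun J h2" "h2 u0 \<noteq> 0"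
    "\<forall>u'. (\<forall>i. i \<notin> J \<longrightarrow> u' i = 0) \<longrightarrow> in_closure J T u' \<longrightarrow> h2 u' \<noteq> 0 \<longrightarrow> u' \<in> T"
    by (elim exE conjE)
  define h where "h = (\<lambda>u. h1 u * h2 u)"
  have h: "polyfun J h" "h u0 \<noteq> 0" using h1 h2 by (auto simp: h_def intro: polyfun.mult)
  have \<Phi>_mem: "\<phi> u \<in> \<Phi> u" "\<phi> u \<in> coord_space n" if "u \<in> T" "h1 u \<noteq> 0" for u
  proof -
    show "\<phi> u \<in> \<Phi> u" using \<Phi>[OF that] by simp
    moreover have "\<Phi> u \<in> proj_space n" using Xp P(6) that(1) by blast
    ultimately show "\<phi> u \<in> coord_space n" using proj_space_coords(2) by blast
  qed
  \<comment> \<open>The parameter \<open>s\<close> sweeps out all multiples of the coordinate vector.\<close>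
  define graph :: "'k \<Rightarrow> (nat \<Rightarrow> 'k) \<Rightarrow> nat + nat \<Rightarrow> 'k"
    where "graph = (\<lambda>s u. case_sum (\<lambda>i. s * \<phi> u i) (case_nat s u))"
  define Z where "Z = {graph s u |s u. u \<in> T}"
  define I :: "(nat + nat) set" where "I = Inl ` {..n}"
  define K :: "(nat + nat) set" where "K = Inr ` insert 0 (Suc ` J)"
  define base :: "(nat + nat \<Rightarrow> 'k) \<Rightarrow> nat \<Rightarrow> 'k" where "base = (\<lambda>w j. w (Inr (Suc j)))"
  define b where "b = (\<lambda>w. w (Inr 0) * h (base w))"
  have graph_simps [simp]: "base (graph s u) = u" "graph s u (Inr 0) = s" "graph s u (Inl i) = s * \<phi> u i"
    for s u i by (auto simp: base_def graph_def)
  have base_poly: "polyfun L (\<lambda>w. base w j)" if "j \<in> J" "K \<subseteq> L" for j L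
    using that by (auto simp: base_def K_def intro!: polyfun.var)
  have graph_poly: "polyfun J (\<lambda>u. p (graph s u))" if "polyfun (I \<union> K) p" for p s
    using that
  proof (rule polyfun_subst)
    fix i assume "i \<in> I \<union> K"
    then consider k where "i = Inl k" | "i = Inr 0" | j where "i = Inr (Suc j)" "j \<in> J"
      by (auto simp: I_def K_def)
    thus "polyfun J (\<lambda>u. graph s u i)"
      by cases (auto simp: graph_def intro: polyfun.intros \<phi>)
  qed
  have b: "polyfun (I \<union> K) b" "\<exists>z\<in>Z. b z \<noteq> 0"
  proof -
    have "polyfun (I \<union> K) (\<lambda>w. h (base w))" by (rule polyfun_subst[OF h(1) base_poly]) auto
    moreover have "polyfun (I \<union> K) (\<lambda>w. w (Inr 0))" by (rule polyfun.var) (auto simp: K_def)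
    ultimately show "polyfun (I \<union> K) b" unfolding b_def by (intro polyfun.mult)
    have "graph 1 u0 \<in> Z" using u0 unfolding Z_def by blast
    thus "\<exists>z\<in>Z. b z \<noteq> 0" using h(2) by (intro bexI) (auto simp: b_def)
  qed
  have irr: "irred_on (I \<union> K) Z"
    unfolding irred_on_def
  proof (intro conjI allI impI)
    show "Z \<noteq> {}" using b(2) by blast
    fix p q assume p: "polyfun (I \<union> K) p" "\<exists>z\<in>Z. p z \<noteq> 0" and q: "polyfun (I \<union> K) q" "\<exists>z\<in>Z. q z \<noteq> 0"
    obtain s u where s: "u \<in> T" "p (graph s u) \<noteq> 0" using p(2) by (auto simp: Z_def)
    obtain s' u' where s': "u' \<in> T" "q (graph s' u') \<noteq> 0" using q(2) by (auto simp: Z_def)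
    have "\<exists>u\<in>T. p (graph s u) \<noteq> 0 \<and> q (graph s' u) \<noteq> 0"
      by (rule irred_onD[OF P(2) graph_poly[OF p(1)] graph_poly[OF q(1)]]) (use s s' in auto)
    then obtain v where v: "v \<in> T" "p (graph s v) \<noteq> 0" "q (graph s' v) \<noteq> 0" by blast
    have curve: "\<exists>P. \<forall>s. graph s v i = poly P s" if i: "i \<in> I \<union> K" for i
    proof -
      consider k where "i = Inl k" | "i = Inr 0" | j where "i = Inr (Suc j)"
        using i by (auto simp: I_def K_def)
      thus ?thesis
      proof cases
        case (1 k)
        thus ?thesis by (intro exI[of _ "monom (\<phi> v k) 1"]) (simp add: graph_def poly_monom)
      next
        case 2
        thus ?thesis by (intro exI[of _ "[:0, 1:]"]) simp
      next
        case (3 j)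
        thus ?thesis by (intro exI[of _ "[:v j:]"]) (simp add: graph_def)
      qed
    qed
    have "\<exists>P. \<forall>s. p (graph s v) = poly P s" by (rule polyfun_along_curve[OF p(1) curve])
    then obtain Pp where Pp: "\<forall>s. p (graph s v) = poly Pp s" by (elim exE)
    have "\<exists>P. \<forall>s. q (graph s v) = poly P s" by (rule polyfun_along_curve[OF q(1) curve])
    then obtain Pq where Pq: "\<forall>s. q (graph s v) = poly Pq s" by (elim exE)
    have "Pp \<noteq> 0" "Pq \<noteq> 0" using v Pp Pq by auto
    hence "Pp * Pq \<noteq> 0" by simp
    then obtain c where c: "poly (Pp * Pq) c \<noteq> 0" using poly_nonzero_value by blast
    have "graph c v \<in> Z" using v(1) unfolding Z_def by blast
    thus "\<exists>z\<in>Z. p z \<noteq> 0 \<and> q z \<noteq> 0" using c Pp Pq by (intro bexI) auto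
  qed
  have "finite K" "I \<inter> K = {}" using P(1) by (auto simp: K_def I_def)
  from extend_point[OF this irr b] obtain a where a: "polyfun I a" "\<exists>z\<in>Z. a z \<noteq> 0"
    "\<forall>w. in_closure I Z w \<longrightarrow> a w \<noteq> 0 \<longrightarrow>
       (\<exists>w'. (\<forall>i\<in>I. w' i = w i) \<and> in_closure (I \<union> K) Z w' \<and> b w' \<noteq> 0)"
    by (elim exE conjE)
  define emb :: "(nat \<Rightarrow> 'k) \<Rightarrow> nat + nat \<Rightarrow> 'k" where "emb = (\<lambda>y. case_sum y (\<lambda>_. 0))"
  have emb_poly: "polyfun {..n} (\<lambda>y. p (emb y))" if "polyfun I p" for p
    by (rule polyfun_subst[OF that]) (auto simp: I_def emb_def intro: polyfun.var)
  have emb_graph: "p (emb (\<lambda>i. s * \<phi> u i)) = p (graph s u)" if "polyfun I p" for p s u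
    by (rule polyfun_cong[OF that]) (auto simp: I_def emb_def)
  define C where "C = {x \<in> proj_space n. \<forall>v\<in>x. a (emb v) = 0}"
  have C: "proj_closed n C" unfolding C_def by (rule proj_closed_zeros[OF emb_poly[OF a(1)]])
  \<comment> \<open>Every coordinate vector of a point of the closure lies in the closure of the projection of \<open>Z\<close>.\<close>
  have cone: "in_closure I Z (emb y)" if y: "x \<in> proj_closure n X" "y \<in> x" for x y
    unfolding in_closure_def
  proof (intro allI impI)
    fix p assume p: "polyfun I p" "\<forall>z\<in>Z. p z = 0"
    let ?D = "{x \<in> proj_space n. \<forall>v\<in>x. p (emb v) = 0}"
    have "X \<subseteq> ?D"
    proof (intro subsetI CollectI conjI ballI)
      fix x v assume x: "x \<in> X"
      show "x \<in> proj_space n" using x Xp by blast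
      assume v: "v \<in> x"
      obtain u' where u': "u' \<in> T" "x = \<Phi> u'" using x P(6) by blast
      from locally_polynomialE[OF P(5) u'(1)] obtain h' \<phi>' where
        h': "polyfun J h'" "h' u' \<noteq> 0" and \<phi>': "\<And>i. polyfun J (\<lambda>u. \<phi>' u i)"
        and \<Phi>': "\<And>u'. u' \<in> T \<Longrightarrow> h' u' \<noteq> 0 \<Longrightarrow> \<Phi> u' = point_of (\<phi>' u')" by metis
      have "v \<in> point_of (\<phi>' u')" using v u' \<Phi>' h'(2) by simp
      then obtain s where s: "v = (\<lambda>i. s * \<phi>' u' i)" by (auto simp: point_of_def)
      show "p (emb v) = 0"
      proof (rule ccontr)
        assume nz: "p (emb v) \<noteq> 0"
        let ?r = "\<lambda>u. p (emb (\<lambda>i. s * \<phi>' u i)) * h' u"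
        have "polyfun J ?r"
          by (intro polyfun.mult h' polyfun_subst[OF emb_poly[OF p(1)]] polyfun.const \<phi>')
        moreover have "?r u' \<noteq> 0" using nz h'(2) by (simp add: s)
        ultimately have "\<exists>u\<in>T. ?r u \<noteq> 0 \<and> h1 u \<noteq> 0"
          using u'(1) u0 h1 by (intro irred_onD[OF P(2)]) blast+
        then obtain u where u: "u \<in> T" "p (emb (\<lambda>i. s * \<phi>' u i)) \<noteq> 0" "h' u \<noteq> 0" "h1 u \<noteq> 0" by auto
        have "\<phi>' u \<in> point_of (\<phi> u)" using \<Phi>[OF u(1,4)] \<Phi>'[OF u(1,3)] point_of_self by metis
        then obtain c where c: "\<phi>' u = (\<lambda>i. c * \<phi> u i)" by (auto simp: point_of_def)
        have "(\<lambda>i. s * \<phi>' u i) = (\<lambda>i. (s * c) * \<phi> u i)" unfolding c by (simp only: mult.assoc)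
        hence "p (emb (\<lambda>i. s * \<phi>' u i)) = p (graph (s * c) u)"
          by (simp only: emb_graph[OF p(1)])
        moreover have "graph (s * c) u \<in> Z" using u(1) unfolding Z_def by blast
        ultimately show False using p(2) u(2) by simp
      qed
    qed
    hence "proj_closure n X \<subseteq> ?D"
      by (intro proj_closure_minimal proj_closed_zeros emb_poly p)
    thus "p (emb y) = 0" using y by blast
  qed
  have "proj_closure n X - C \<subseteq> X"
  proof
    fix x assume x: "x \<in> proj_closure n X - C"
    hence xp: "x \<in> proj_space n" using clp by blast
    then obtain y where y: "y \<in> x" "a (emb y) \<noteq> 0" using x by (auto simp: C_def)
    obtain w where w: "\<forall>i\<in>I. w i = emb y i" "in_closure (I \<union> K) Z w" "b w \<noteq> 0"
      using a(3) cone[OF _ y(1)] x y(2) by blast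
    define s where "s = w (Inr 0)"
    define u where "u = (\<lambda>j. if j \<in> J then base w j else 0)"
    have s0: "s \<noteq> 0" using w(3) by (auto simp: b_def s_def)
    have agree: "p u = p (base w)" if "polyfun J p" for p
      by (rule polyfun_cong[OF that]) (simp add: u_def)
    have hu: "h1 u \<noteq> 0" "h2 u \<noteq> 0"
      using w(3) agree[OF h(1)] by (auto simp: b_def h_def)
    have "in_closure J T (base w)"
    proof (rule in_closure_image[OF w(2)])
      show "base z \<in> T" if "z \<in> Z" for z using that by (auto simp: Z_def)
    qed (rule base_poly, auto)
    hence "in_closure J T u"
      unfolding in_closure_def by (intro allI impI) (simp add: agree)
    hence uT: "u \<in> T" using h2(3) hu(2) by (simp add: u_def)
    have "y i = s * \<phi> u i" for i
    proof (cases "i \<le> n")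
      case True
      let ?p = "\<lambda>w. w (Inl i) - w (Inr 0) * \<phi> (base w) i"
      have "polyfun (I \<union> K) (\<lambda>w. \<phi> (base w) i)" by (rule polyfun_subst[OF \<phi> base_poly]) auto
      hence "polyfun (I \<union> K) ?p"
        using True by (intro polyfun_diff polyfun.mult polyfun.var) (auto simp: I_def K_def)
      moreover have "\<forall>z\<in>Z. ?p z = 0" by (auto simp: Z_def)
      ultimately have "?p w = 0" using spec[OF w(2)[unfolded in_closure_def], of ?p] by simp
      moreover have "w (Inl i) = y i" using w(1) True by (auto simp: I_def emb_def)
      ultimately show ?thesis using agree[OF \<phi>, of i] by (simp add: s_def)
    next
      case False
      thus ?thesis
        using proj_space_coords(2)[OF xp y(1)] \<Phi>_mem(2)[OF uT hu(1)] by (simp add: coord_space_def)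
    qed
    hence "y = (\<lambda>i. s * \<phi> u i)" by blast
    hence "x = \<Phi> u"
      using proj_space_coords(1)[OF xp y(1)] point_of_scale[OF s0] \<Phi>[OF uT hu(1)] by simp
    thus "x \<in> X" using uT P(6) by blast
  qed
  moreover have "\<not> proj_closure n X \<subseteq> C"
  proof -
    have "\<exists>z\<in>Z. a z \<noteq> 0 \<and> b z \<noteq> 0"
      by (rule irred_onD[OF irr polyfun_mono[OF a(1)] b(1) a(2) b(2)]) auto
    then obtain s u where u: "u \<in> T" "a (graph s u) \<noteq> 0" "b (graph s u) \<noteq> 0" by (auto simp: Z_def)
    hence nz: "s \<noteq> 0" "h1 u \<noteq> 0" by (auto simp: b_def h_def)
    have "(\<lambda>i. s * \<phi> u i) \<in> \<Phi> u" using \<Phi>[OF u(1) nz(2)] nz(1) by (auto simp: point_of_def)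
    moreover have "a (emb (\<lambda>i. s * \<phi> u i)) \<noteq> 0" using u(2) by (simp add: emb_graph[OF a(1)])
    ultimately have "\<Phi> u \<notin> C" unfolding C_def by blast
    moreover have "\<Phi> u \<in> proj_closure n X" using u(1) P(6) proj_closure_subset[of X n] by blast
    ultimately show ?thesis by blast
  qed
  ultimately show ?thesis using C by blast
qed

lemma parametrized_rational_image:
  fixes \<Gamma> :: "'k::alg_closed_field point set"
  assumes \<Gamma>: "proj_closed m \<Gamma>" "proj_irreducible m \<Gamma>"
    and f: "rational_map m \<Gamma> n Y U f" and Y: "Y \<subseteq> proj_space n"
  shows "parametrized n (f ` U)"
proof -
  obtain C where C: "proj_closed m C" "U = \<Gamma> - C" and "U \<noteq> {}" and mor: "morphism m U n Y f"
    using f unfolding rational_map_def by (elim conjE exE)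
  have Up: "U \<subseteq> proj_space m" using C(2) proj_closed_subset[OF \<Gamma>(1)] by blast
  have "proj_irreducible m U"
    unfolding proj_irreducible_def
  proof (intro conjI allI impI \<open>U \<noteq> {}\<close>)
    fix A B assume AB: "proj_closed m A" "proj_closed m B" "U \<subseteq> A \<union> B"
    have "\<Gamma> \<subseteq> A \<union> (B \<union> C)" using AB(3) C(2) by blast
    hence "\<Gamma> \<subseteq> A \<or> \<Gamma> \<subseteq> B \<union> C"
      using \<Gamma>(2) AB(1) proj_closed_Un[OF AB(2) C(1)] unfolding proj_irreducible_def by blast
    thus "U \<subseteq> A \<or> U \<subseteq> B" using C(2) by blast
  qed
  hence irr: "irred_on {..m} (\<Union>U)" by (rule irred_on_cone[OF Up])
  have coords: "v \<in> coord_space m" "v \<noteq> (\<lambda>_. 0)" "point_of v \<in> U" if "v \<in> \<Union>U" for v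
    using that Up proj_space_coords[of _ m v] by auto
  have "\<exists>h. polyfun {..m} h \<and> h u \<noteq> 0 \<and>
      (\<forall>u'. (\<forall>i. i \<notin> {..m} \<longrightarrow> u' i = 0) \<longrightarrow> in_closure {..m} (\<Union>U) u' \<longrightarrow> h u' \<noteq> 0 \<longrightarrow> u' \<in> \<Union>U)"
    if u: "u \<in> \<Union>U" for u
  proof -
    have pu: "point_of u \<in> proj_space m" "point_of u \<notin> C" using coords(3)[OF u] Up C(2) by auto
    obtain d g where g: "formfun m d g" "g u \<noteq> 0" "\<And>y v. y \<in> C \<Longrightarrow> v \<in> y \<Longrightarrow> g v = 0"
      using proj_closed_separating_form[OF C(1) pu] point_of_self by metis
    obtain i where i: "u i \<noteq> 0" using coords(2)[OF u] by auto
    have im: "i \<le> m" using coords(1)[OF u] i by (auto simp: coord_space_def not_le[symmetric])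
    show ?thesis
      \<comment> \<open>the factor \<open>v i\<close> excludes the zero vector, which lies in the closure of a cone\<close>
    proof (intro exI[of _ "\<lambda>v. g v * v i"] conjI allI impI)
      show "polyfun {..m} (\<lambda>v. g v * v i)"
        using im by (intro polyfun.mult formfun_polyfun[OF g(1)] polyfun.var) simp
      show "g u * u i \<noteq> 0" using g i by simp
      fix u' assume u': "\<forall>i. i \<notin> {..m} \<longrightarrow> u' i = 0" "in_closure {..m} (\<Union>U) u'" "g u' * u' i \<noteq> 0"
      have "point_of u' \<in> proj_space m"
        using u'(1,3) by (intro proj_spaceI) (auto simp: coord_space_def)
      moreover have "point_of u' \<notin> C" using g(3)[OF _ point_of_self, of u'] u'(3) by auto
      moreover have "point_of u' \<in> \<Gamma>"
      proof (rule ccontr)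
        assume "point_of u' \<notin> \<Gamma>"
        then obtain e q where q: "formfun m e q" "q u' \<noteq> 0" "\<And>y v. y \<in> \<Gamma> \<Longrightarrow> v \<in> y \<Longrightarrow> q v = 0"
          using proj_closed_separating_form[OF \<Gamma>(1) \<open>point_of u' \<in> proj_space m\<close>] point_of_self by metis
        have "\<forall>z\<in>\<Union>U. q z = 0" using q(3) C(2) by blast
        thus False using spec[OF u'(2)[unfolded in_closure_def], of q] formfun_polyfun[OF q(1)] q(2) by simp
      qed
      ultimately have "point_of u' \<in> U" using C(2) by simp
      thus "u' \<in> \<Union>U" using point_of_self by blast
    qed
  qed
  moreover have "locally_polynomial {..m} (\<Union>U) (\<lambda>v. f (point_of v))"
    by (rule locally_polynomial_morphism[OF mor locally_polynomial_point_of]) (use coords in auto)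
  moreover have "(\<lambda>v. f (point_of v)) ` \<Union>U = f ` U"
  proof (intro equalityI subsetI)
    fix y assume "y \<in> f ` U"
    then obtain x where x: "x \<in> U" "y = f x" by blast
    moreover obtain v where v: "v \<in> x" using proj_space_nonempty x(1) Up by blast
    moreover have "x = point_of v" using proj_space_coords(1) v x(1) Up by blast
    ultimately show "y \<in> (\<lambda>v. f (point_of v)) ` \<Union>U" by (intro image_eqI[of _ _ v]) auto
  next
    fix y assume "y \<in> (\<lambda>v. f (point_of v)) ` \<Union>U"
    then obtain v where "v \<in> \<Union>U" "y = f (point_of v)" by blast
    thus "y \<in> f ` U" using coords(3)[of v] by blast
  qed
  moreover have "f ` U \<subseteq> proj_space n" using conjunct1[OF mor[unfolded morphism_def]] Y by blast
  moreover have "\<forall>u\<in>\<Union>U. \<forall>i. i \<notin> {..m} \<longrightarrow> u i = 0"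
    using coords(1) by (auto simp: coord_space_def not_le)
  ultimately have "parametrization n {..m} (\<Union>U) (\<lambda>v. f (point_of v))" "(\<lambda>v. f (point_of v)) ` \<Union>U = f ` U"
    using irr unfolding parametrization_def by simp_all
  thus ?thesis unfolding parametrized_def by blast
qed

section \<open>Translating rational maps and chains\<close>

lemma formfun_biform_subst:
  assumes H: "biform n n' d e H" and s: "\<And>j. j \<le> n \<Longrightarrow> formfun m c (\<lambda>v. s v j)"
  shows "formfun m (c * d) (\<lambda>v. eval H (case_sum (s v) w))"
  unfolding eval_def
proof (rule formfun_sum)
  fix M assume M: "M \<in> Poly_Mapping.keys H"
  let ?l = "Poly_Mapping.lookup M"
  have keys: "Poly_Mapping.keys M \<subseteq> Inl ` {..n} \<union> Inr ` {..n'}" and deg: "(\<Sum>i\<le>n. ?l (Inl i)) = d"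
    using bspec[OF H[unfolded biform_def] M] by auto
  have split: "(\<Prod>k\<in>Poly_Mapping.keys M. case_sum (s v) w k ^ ?l k)
      = (\<Prod>i\<le>n. s v i ^ ?l (Inl i)) * (\<Prod>j\<le>n'. w j ^ ?l (Inr j))" for v
    by (subst prod_keys_over_superset[OF _ keys], simp, subst prod.union_disjoint)
      (auto simp: prod.reindex inj_on_def)
  have "formfun m (\<Sum>i\<le>n. c * ?l (Inl i)) (\<lambda>v. \<Prod>i\<le>n. s v i ^ ?l (Inl i))"
    by (rule formfun_prod[OF finite_atMost formfun_power[OF s]]) simp
  hence "formfun m (c * d) (\<lambda>v. \<Prod>i\<le>n. s v i ^ ?l (Inl i))"
    by (simp only: deg flip: sum_distrib_left)
  from formfun_mult[OF formfun_const[of _ "Poly_Mapping.lookup H M"]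
      formfun_mult[OF this formfun_const[of _ "\<Prod>j\<le>n'. w j ^ ?l (Inr j)"]]]
  show "formfun m (c * d)
      (\<lambda>v. Poly_Mapping.lookup H M * (\<Prod>k\<in>Poly_Mapping.keys M. case_sum (s v) w k ^ ?l k))"
    unfolding split by (simp only: add_0_left add_0_right)
qed

lemma morphism_mult_right:
  fixes X :: "'k::field point set"
  assumes X: "X \<subseteq> proj_space m" and f: "morphism m X n Y f"
    and g: "morphism2 n Y n' Y' l W g" and c: "c \<in> Y'" "Y' \<subseteq> proj_space n'"
  shows "morphism m X l W (\<lambda>x. g (f x) c)"
  unfolding morphism_def
proof (intro conjI ballI)
  have fY: "f x \<in> Y" if "x \<in> X" for x using conjunct1[OF f[unfolded morphism_def]] that by blast
  show "(\<lambda>x. g (f x) c) ` X \<subseteq> W"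
    using conjunct1[OF g[unfolded morphism2_def]] fY c(1) by blast
  obtain w where w: "w \<in> c" using proj_space_nonempty c by blast
  fix x assume x: "x \<in> X"
  from bspec[OF conjunct2[OF f[unfolded morphism_def]] x] obtain d F where
    F: "\<forall>j\<le>n. form m d (F j)" "\<forall>v\<in>x. \<exists>j\<le>n. eval (F j) v \<noteq> 0"
    "\<forall>y\<in>X. \<forall>v\<in>y. (\<exists>j\<le>n. eval (F j) v \<noteq> 0) \<longrightarrow>
           f y = point_of (\<lambda>j. if j \<le> n then eval (F j) v else 0)"
    by (elim exE conjE)
  define \<phi> where "\<phi> = (\<lambda>v j. if j \<le> n then eval (F j) v else 0)"
  from bspec[OF bspec[OF conjunct2[OF g[unfolded morphism2_def]] fY[OF x]] c(1)] obtain e e' H where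
    H: "\<forall>j\<le>l. biform n n' e e' (H j)"
    "\<forall>v\<in>f x. \<forall>v'\<in>c. \<exists>j\<le>l. eval (H j) (case_sum v v') \<noteq> 0"
    "\<forall>y\<in>Y. \<forall>y'\<in>Y'. \<forall>v\<in>y. \<forall>v'\<in>y'. (\<exists>j\<le>l. eval (H j) (case_sum v v') \<noteq> 0) \<longrightarrow>
       g y y' = point_of (\<lambda>j. if j \<le> l then eval (H j) (case_sum v v') else 0)"
    by (elim exE conjE)
  have \<phi>_mem: "\<phi> v \<in> f y" if "y \<in> X" "v \<in> y" "\<exists>j\<le>n. eval (F j) v \<noteq> 0" for y v
    using F(3)[rule_format, OF that(1,2)] that(3) by (auto simp: \<phi>_def)
  obtain v0 where v0: "v0 \<in> x" using proj_space_nonempty x X by blast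
  obtain j0 where j0: "j0 \<le> n" "eval (F j0) v0 \<noteq> 0" using F(2) v0 by blast
  have j0_all: "eval (F j0) v \<noteq> 0" if v: "v \<in> x" for v
  proof -
    have "x = point_of v0" using proj_space_coords(1) v0 x X by blast
    then obtain b where b: "b \<noteq> 0" "v = (\<lambda>i. b * v0 i)" using v by (auto simp: point_of_def)
    have "formfun m d (eval (F j0))" using F(1) j0(1) by (intro formfunI) simp
    from formfun_scale[OF this, of b v0] show ?thesis using b j0(2) by simp
  qed
  \<comment> \<open>The factor \<open>F j0\<close> keeps the formula from being used where the forms \<open>F\<close> do not define \<open>f\<close>.\<close>
  define L where "L = (\<lambda>j v. eval (H j) (case_sum (\<phi> v) w) * eval (F j0) v)"
  have "\<exists>q. form m (d * e + d) q \<and> eval q = L j" if j: "j \<le> l" for j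
  proof -
    have "formfun m d (\<lambda>v. \<phi> v i)" if "i \<le> n" for i
      using F(1) that formfunI[of m d "F i"] by (simp add: \<phi>_def)
    from formfun_biform_subst[of n n' e e' "H j", OF _ this] have
      "formfun m (d * e) (\<lambda>v. eval (H j) (case_sum (\<phi> v) w))" using H(1) j by simp
    moreover have "formfun m d (eval (F j0))" using F(1) j0(1) by (intro formfunI) simp
    ultimately have "formfun m (d * e + d) (L j)" unfolding L_def by (rule formfun_mult)
    thus ?thesis by (auto simp: formfun_def)
  qed
  then obtain q where q: "\<And>j. j \<le> l \<Longrightarrow> form m (d * e + d) (q j)" "\<And>j. j \<le> l \<Longrightarrow> eval (q j) = L j"
    by metis
  show "\<exists>d F. (\<forall>j\<le>l. form m d (F j)) \<and> (\<forall>v\<in>x. \<exists>j\<le>l. eval (F j) v \<noteq> 0) \<and>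
      (\<forall>y\<in>X. \<forall>v\<in>y. (\<exists>j\<le>l. eval (F j) v \<noteq> 0) \<longrightarrow>
         g (f y) c = point_of (\<lambda>j. if j \<le> l then eval (F j) v else 0))"
  proof (rule exI[of _ "d * e + d"], rule exI[of _ q], intro conjI allI ballI impI)
    fix v assume v: "v \<in> x"
    obtain j where "j \<le> l" "eval (H j) (case_sum (\<phi> v) w) \<noteq> 0"
      using H(2) \<phi>_mem[OF x v] F(2) v w by blast
    thus "\<exists>j\<le>l. eval (q j) v \<noteq> 0" using q(2) j0_all[OF v] by (auto simp: L_def)
  next
    fix y v assume y: "y \<in> X" and v: "v \<in> y" and nz: "\<exists>j\<le>l. eval (q j) v \<noteq> 0"
    then obtain j where j: "j \<le> l" "L j v \<noteq> 0" using q(2) by auto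
    hence F0: "eval (F j0) v \<noteq> 0" and Hj: "eval (H j) (case_sum (\<phi> v) w) \<noteq> 0" by (auto simp: L_def)
    have "\<phi> v \<in> f y" using \<phi>_mem[OF y v] F0 j0(1) by blast
    hence "g (f y) c = point_of (\<lambda>j. if j \<le> l then eval (H j) (case_sum (\<phi> v) w) else 0)"
      using H(3)[rule_format, OF fY[OF y] c(1) _ w] j(1) Hj by blast
    also have "\<dots> = point_of (\<lambda>j. eval (F j0) v * (if j \<le> l then eval (H j) (case_sum (\<phi> v) w) else 0))"
      by (rule point_of_scale[OF F0, symmetric])
    also have "\<dots> = point_of (\<lambda>j. if j \<le> l then eval (q j) v else 0)"
      by (intro arg_cong[of _ _ point_of]) (auto simp: q(2) L_def fun_eq_iff)
    finally show "g (f y) c = point_of (\<lambda>j. if j \<le> l then eval (q j) v else 0)" .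
  qed (use q in auto)
qed

lemma gamma_equiv_sym:
  assumes "gamma_equiv m \<Gamma> n G a b" shows "gamma_equiv m \<Gamma> n G b a"
proof -
  obtain N g where g: "\<forall>j\<le>N. g j \<in> carrier G" "g 0 = a" "g N = b"
    "\<forall>j<N. gamma_link m \<Gamma> n G (g j) (g (Suc j))"
    using assms unfolding gamma_equiv_def by blast
  have "gamma_link m \<Gamma> n G (g (N - j)) (g (N - Suc j))" if "j < N" for j
  proof -
    have "gamma_link m \<Gamma> n G (g (N - Suc j)) (g (Suc (N - Suc j)))" using g(4) that by simp
    hence "gamma_link m \<Gamma> n G (g (N - Suc j)) (g (N - j))" using that by (simp add: Suc_diff_Suc)
    thus ?thesis unfolding gamma_link_def by blast
  qed
  thus ?thesis unfolding gamma_equiv_def using g(1-3)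
    by (intro exI[of _ N] exI[of _ "\<lambda>j. g (N - j)"]) auto
qed

lemma gamma_equiv_trans:
  assumes "gamma_equiv m \<Gamma> n G a b" "gamma_equiv m \<Gamma> n G b c"
  shows "gamma_equiv m \<Gamma> n G a c"
proof -
  obtain N g where g: "\<forall>j\<le>N. g j \<in> carrier G" "g 0 = a" "g N = b"
    "\<forall>j<N. gamma_link m \<Gamma> n G (g j) (g (Suc j))"
    using assms(1) unfolding gamma_equiv_def by blast
  obtain M h where h: "\<forall>j\<le>M. h j \<in> carrier G" "h 0 = b" "h M = c"
    "\<forall>j<M. gamma_link m \<Gamma> n G (h j) (h (Suc j))"
    using assms(2) unfolding gamma_equiv_def by blast
  let ?k = "\<lambda>j. if j \<le> N then g j else h (j - N)"
  have "gamma_link m \<Gamma> n G (?k j) (?k (Suc j))" if "j < N + M" for j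
  proof -
    consider "j < N" | "j = N" | "N < j" by linarith
    thus ?thesis
    proof cases
      case 2
      thus ?thesis using h(2,4) g(3) that by auto
    next
      case 3
      moreover from 3 have "j - N < M" "Suc j - N = Suc (j - N)" using that by auto
      ultimately show ?thesis using h(4) by auto
    qed (use g(4) in auto)
  qed
  moreover have "?k (N + M) = c" using g(3) h(2,3) by auto
  ultimately show ?thesis unfolding gamma_equiv_def using g(1,2) h(1)
    by (intro exI[of _ "N + M"] exI[of _ ?k]) auto
qed

lemma gamma_equiv_link:
  "a \<in> carrier G \<Longrightarrow> b \<in> carrier G \<Longrightarrow> gamma_link m \<Gamma> n G a b \<Longrightarrow> gamma_equiv m \<Gamma> n G a b"
  unfolding gamma_equiv_def
  by (intro exI[of _ 1] exI[of _ "\<lambda>j. if j = 0 then a else b"]) auto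

lemma gamma_equiv_refl: "a \<in> carrier G \<Longrightarrow> gamma_equiv m \<Gamma> n G a a"
  unfolding gamma_equiv_def by (intro exI[of _ 0] exI[of _ "\<lambda>_. a"]) auto

section \<open>Subgroups swept out by parametrized sets\<close>

locale projective_group = group G for G :: "'k::alg_closed_field point monoid" (structure) +
  fixes n :: nat
  assumes carrier_closed: "proj_closed n (carrier G)"
    and mult_morphism: "morphism2 n (carrier G) n (carrier G) n (carrier G) (\<lambda>x y. x \<otimes> y)"
    and inv_morphism: "morphism n (carrier G) n (carrier G) (\<lambda>x. inv x)"
begin

lemma carrier_subset: "carrier G \<subseteq> proj_space n"
  by (rule proj_closed_subset[OF carrier_closed])

lemma point_of_carrier: "v \<in> \<Union>(carrier G) \<Longrightarrow> point_of v \<in> carrier G"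
  using proj_space_coords(1) carrier_subset by fastforce

lemma locally_polynomial_carrier: "locally_polynomial {..n} (\<Union>(carrier G)) point_of"
  using proj_space_coords(2) carrier_subset by (intro locally_polynomial_point_of) blast

lemma closed_preimage_carrier:
  assumes f: "locally_polynomial {..n} (\<Union>(carrier G)) (\<lambda>v. f (point_of v))"
    "\<And>x. x \<in> carrier G \<Longrightarrow> f x \<in> carrier G" and C: "proj_closed n C"
  shows "proj_closed n {x \<in> carrier G. f x \<in> C}"
proof -
  have "proj_closed n {x \<in> carrier G. \<forall>v\<in>x. f (point_of v) \<in> C}"
    by (rule proj_closed_preimage[OF carrier_closed C f(1)])
      (use f(2) point_of_carrier carrier_subset in blast)
  moreover have "(\<forall>v\<in>x. f (point_of v) \<in> C) \<longleftrightarrow> f x \<in> C" if "x \<in> carrier G" for x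
  proof -
    have x: "x \<in> proj_space n" using that carrier_subset by blast
    then obtain v where v: "v \<in> x" using proj_space_nonempty by blast
    have "point_of u = x" if "u \<in> x" for u using proj_space_coords(1)[OF x that] by simp
    thus ?thesis using v by auto
  qed
  hence "{x \<in> carrier G. \<forall>v\<in>x. f (point_of v) \<in> C} = {x \<in> carrier G. f x \<in> C}" by blast
  ultimately show ?thesis by simp
qed

lemma closed_preimage_mult_right:
  assumes "a \<in> carrier G" "proj_closed n C"
  shows "proj_closed n {x \<in> carrier G. x \<otimes> a \<in> C}"
proof (rule closed_preimage_carrier[OF _ _ assms(2)])
  show "locally_polynomial {..n} (\<Union>(carrier G)) (\<lambda>v. point_of v \<otimes> a)"
    by (rule locally_polynomial_morphism2[OF mult_morphism locally_polynomial_carrier _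
          locally_polynomial_const[of a n]])
      (use assms(1) carrier_subset point_of_carrier in auto)
qed (use assms(1) in auto)

lemma closed_preimage_mult_left:
  assumes "a \<in> carrier G" "proj_closed n C"
  shows "proj_closed n {x \<in> carrier G. a \<otimes> x \<in> C}"
proof (rule closed_preimage_carrier[OF _ _ assms(2)])
  show "locally_polynomial {..n} (\<Union>(carrier G)) (\<lambda>v. a \<otimes> point_of v)"
    by (rule locally_polynomial_morphism2[OF mult_morphism locally_polynomial_const[of a n] _
          locally_polynomial_carrier])
      (use assms(1) carrier_subset point_of_carrier in auto)
qed (use assms(1) in auto)

lemma closed_preimage_inv:
  assumes "proj_closed n C"
  shows "proj_closed n {x \<in> carrier G. inv x \<in> C}"
proof (rule closed_preimage_carrier[OF _ _ assms])
  show "locally_polynomial {..n} (\<Union>(carrier G)) (\<lambda>v. inv (point_of v))"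
    by (rule locally_polynomial_morphism[OF inv_morphism locally_polynomial_carrier])
      (use point_of_carrier in auto)
qed auto

lemma parametrized_mult:
  assumes "parametrized n X" "X \<subseteq> carrier G" "parametrized n Y" "Y \<subseteq> carrier G"
  shows "parametrized n {x \<otimes> y |x y. x \<in> X \<and> y \<in> Y}"
  by (rule parametrized_morphism2_image[OF mult_morphism carrier_subset assms])

text \<open>
  Among the parametrized subsets of \<open>H\<close> through the identity, one, \<open>P\<close>, has a maximal closure \<open>A\<close>.
  Multiplying \<open>P\<close> by any other of them cannot enlarge the closure, so \<open>A\<close> absorbs all of \<open>H\<close>.
  Conversely \<open>P\<close> contains a nonempty open subset \<open>V\<close> of \<open>A\<close>. For \<open>a \<in> A\<close>, the sets \<open>V\<close> and
  \<open>{a \<otimes> inv v |v. v \<in> V}\<close> are nonempty and open in the irreducible set \<open>A\<close>, so they meet, and \<open>a\<close> is a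
  product of two elements of \<open>V \<subseteq> H\<close>.
\<close>

lemma subgroup_swept_out_is_closed:
  assumes H: "subgroup H G"
    and cover: "\<And>h. h \<in> H \<Longrightarrow> \<exists>X. parametrized n X \<and> X \<subseteq> H \<and> \<one> \<in> X \<and> h \<in> X"
  shows "proj_closed n H \<and> proj_irreducible n H"
proof -
  define \<P> where "\<P> = {X. parametrized n X \<and> X \<subseteq> H \<and> \<one> \<in> X}"
  have HG: "H \<subseteq> carrier G" by (rule subgroup.subset[OF H])
  have Pp: "X \<subseteq> proj_space n" "proj_irreducible n X" if "X \<in> \<P>" for X
    using that parametrized_subset parametrized_irreducible by (auto simp: \<P>_def)
  have prod: "{x \<otimes> y |x y. x \<in> X \<and> y \<in> Y} \<in> \<P>" if XY: "X \<in> \<P>" "Y \<in> \<P>" for X Y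
  proof -
    have "parametrized n {x \<otimes> y |x y. x \<in> X \<and> y \<in> Y}"
      using XY HG by (intro parametrized_mult) (auto simp: \<P>_def)
    moreover have "{x \<otimes> y |x y. x \<in> X \<and> y \<in> Y} \<subseteq> H"
      using XY subgroup.m_closed[OF H] by (auto simp: \<P>_def)
    moreover have "\<one> \<in> {x \<otimes> y |x y. x \<in> X \<and> y \<in> Y}"
      using XY by (auto simp: \<P>_def intro!: exI[of _ \<one>])
    ultimately show ?thesis by (simp add: \<P>_def)
  qed
  have "\<exists>A\<in>proj_closure n ` \<P>. \<forall>B\<in>proj_closure n ` \<P>. A \<subseteq> B \<longrightarrow> B = A"
  proof (rule maximal_irreducible_closed)
    show "proj_closure n ` \<P> \<noteq> {}"
      using cover[OF subgroup.one_closed[OF H]] by (auto simp: \<P>_def)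
    fix A assume "A \<in> proj_closure n ` \<P>"
    then obtain X where "X \<in> \<P>" "A = proj_closure n X" by blast
    thus "proj_closed n A \<and> proj_irreducible n A"
      using proj_closed_closure[OF Pp(1)] proj_irreducible_closure[OF Pp(2)] by simp
  qed
  then obtain P where P: "P \<in> \<P>"
    and max: "\<And>Q. Q \<in> \<P> \<Longrightarrow> proj_closure n P \<subseteq> proj_closure n Q \<Longrightarrow> proj_closure n Q = proj_closure n P"
    by blast
  define A where "A = proj_closure n P"
  have A: "proj_closed n A" "proj_irreducible n A" "P \<subseteq> A"
    unfolding A_def using proj_closed_closure[OF Pp(1)[OF P]] proj_irreducible_closure[OF Pp(2)[OF P]]
      proj_closure_subset by simp_all
  have PH: "P \<subseteq> H" "\<one> \<in> P" using P by (auto simp: \<P>_def)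
  have AG: "A \<subseteq> carrier G"
    unfolding A_def using carrier_closed PH(1) HG by (intro proj_closure_minimal) auto
  have minimal: "A \<subseteq> {x \<in> carrier G. f x \<in> A}"
    if "proj_closed n {x \<in> carrier G. f x \<in> A}" "\<And>x. x \<in> P \<Longrightarrow> f x \<in> A" for f
    using proj_closure_minimal[OF that(1), of P] that(2) PH(1) HG unfolding A_def by blast
  have PH_A: "x \<otimes> h \<in> A" if x: "x \<in> P" and h: "h \<in> H" for x h
  proof -
    obtain Q where Q: "Q \<in> \<P>" "h \<in> Q" using cover[OF h] by (auto simp: \<P>_def)
    let ?R = "{x \<otimes> y |x y. x \<in> P \<and> y \<in> Q}"
    have "P \<subseteq> ?R"
    proof
      fix x assume "x \<in> P"
      moreover have "\<one> \<in> Q" using Q(1) by (simp add: \<P>_def)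
      moreover have "x = x \<otimes> \<one>" using \<open>x \<in> P\<close> PH(1) HG by auto
      ultimately show "x \<in> ?R" by blast
    qed
    hence "P \<subseteq> proj_closure n ?R" using proj_closure_subset[of ?R n] by blast
    hence "proj_closure n P \<subseteq> proj_closure n ?R"
      using Pp(1)[OF prod[OF P Q(1)]] by (intro proj_closure_minimal proj_closed_closure)
    hence "proj_closure n ?R = A" unfolding A_def by (rule max[OF prod[OF P Q(1)]])
    hence "?R \<subseteq> A" using proj_closure_subset[of ?R n] by simp
    thus ?thesis using x Q(2) by blast
  qed
  have HA: "H \<subseteq> A"
  proof
    fix h assume "h \<in> H"
    thus "h \<in> A" using PH_A[OF PH(2), of h] HG by auto
  qed
  have A_mult: "a \<otimes> b \<in> A" if ab: "a \<in> A" "b \<in> A" for a b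
  proof -
    have AP: "a \<otimes> p \<in> A" if "p \<in> P" for p
      using minimal[OF closed_preimage_mult_right[of p A]] PH_A that ab(1) PH(1) HG A(1) by blast
    show ?thesis
      using minimal[OF closed_preimage_mult_left[of a A]] AP ab AG A(1) by blast
  qed
  have A_inv: "inv a \<in> A" if "a \<in> A" for a
    using minimal[OF closed_preimage_inv[OF A(1)]] subgroup.m_inv_closed[OF H] HA PH(1) that by blast
  obtain C where C: "proj_closed n C" "\<not> A \<subseteq> C" "A - C \<subseteq> P"
    using parametrized_contains_open[of n P] P unfolding A_def \<P>_def by blast
  have "A \<subseteq> H"
  proof
    fix a assume a: "a \<in> A"
    \<comment> \<open>within \<open>A\<close>, the complement of \<open>?D\<close> is \<open>{a \<otimes> inv v |v. v \<in> A - C}\<close>\<close>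
    let ?D = "{x \<in> carrier G. inv x \<in> {y \<in> carrier G. y \<otimes> a \<in> C}}"
    have D: "proj_closed n ?D"
      using a AG C(1) by (intro closed_preimage_inv closed_preimage_mult_right) auto
    have "\<not> A \<subseteq> ?D"
    proof -
      obtain v where v: "v \<in> A" "v \<notin> C" using C(2) by blast
      have vG: "v \<in> carrier G" "a \<in> carrier G" using v(1) a AG by auto
      have "inv (a \<otimes> inv v) \<otimes> a = v" using vG by (simp add: inv_mult_group m_assoc)
      hence "a \<otimes> inv v \<notin> ?D" using v(2) by simp
      moreover have "a \<otimes> inv v \<in> A" using a v(1) A_mult A_inv by blast
      ultimately show ?thesis by blast
    qed
    hence "\<not> A \<subseteq> C \<union> ?D" using A(2) C(1,2) D unfolding proj_irreducible_def by blast
    then obtain x where x: "x \<in> A" "x \<notin> C" "x \<notin> ?D" by blast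
    have xG: "x \<in> carrier G" "a \<in> carrier G" using x(1) a AG by auto
    have "inv x \<otimes> a \<in> A" using x(1) a A_mult A_inv by blast
    moreover have "inv x \<otimes> a \<notin> C" using x(3) xG by simp
    ultimately have "inv x \<otimes> a \<in> H" "x \<in> H" using x(1,2) C(3) PH(1) by blast+
    hence "x \<otimes> (inv x \<otimes> a) \<in> H" by (rule subgroup.m_closed[OF H, rotated])
    thus "a \<in> H" using xG by (simp flip: m_assoc)
  qed
  with HA A(1,2) show ?thesis by simp
qed

section \<open>The Gamma-class of the identity\<close>

context
  fixes m :: nat and \<Gamma> :: "'k point set"
  assumes \<Gamma>: "proj_closed m \<Gamma>" "proj_irreducible m \<Gamma>"
begin

lemma gamma_link_mult_right:
  assumes "gamma_link m \<Gamma> n G a b" "c \<in> carrier G"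
  shows "gamma_link m \<Gamma> n G (a \<otimes> c) (b \<otimes> c)"
proof -
  obtain U f p q where f: "rational_map m \<Gamma> n (carrier G) U f" "p \<in> U" "q \<in> U" "f p = a" "f q = b"
    using assms(1) unfolding gamma_link_def by (elim exE conjE)
  have U: "U \<noteq> {}" "\<exists>C. proj_closed m C \<and> U = \<Gamma> - C" "morphism m U n (carrier G) f"
    using f(1) unfolding rational_map_def by simp_all
  have "U \<subseteq> proj_space m" using U(2) proj_closed_subset[OF \<Gamma>(1)] by blast
  hence "morphism m U n (carrier G) (\<lambda>x. f x \<otimes> c)"
    by (rule morphism_mult_right[OF _ U(3) mult_morphism assms(2) carrier_subset])
  hence "rational_map m \<Gamma> n (carrier G) U (\<lambda>x. f x \<otimes> c)" using U unfolding rational_map_def by simp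
  thus ?thesis unfolding gamma_link_def
    by (intro exI[of _ U] exI[of _ "\<lambda>x. f x \<otimes> c"] exI[of _ p] exI[of _ q]) (simp add: f)
qed

lemma gamma_equiv_mult_right:
  assumes "gamma_equiv m \<Gamma> n G a b" "c \<in> carrier G"
  shows "gamma_equiv m \<Gamma> n G (a \<otimes> c) (b \<otimes> c)"
proof -
  obtain N g where g: "\<forall>j\<le>N. g j \<in> carrier G" "g 0 = a" "g N = b"
    "\<forall>j<N. gamma_link m \<Gamma> n G (g j) (g (Suc j))"
    using assms(1) unfolding gamma_equiv_def by blast
  thus ?thesis unfolding gamma_equiv_def using assms(2)
    by (intro exI[of _ N] exI[of _ "\<lambda>j. g j \<otimes> c"]) (auto intro: gamma_link_mult_right)
qed

lemma gamma_class_subgroup: "subgroup (gamma_class m \<Gamma> n G \<one>) G"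
proof (rule subgroup.intro)
  show "gamma_class m \<Gamma> n G \<one> \<subseteq> carrier G" by (auto simp: gamma_class_def)
  show "\<one> \<in> gamma_class m \<Gamma> n G \<one>" by (auto simp: gamma_class_def intro: gamma_equiv_refl)
  fix x assume x: "x \<in> gamma_class m \<Gamma> n G \<one>"
  hence xG: "x \<in> carrier G" "gamma_equiv m \<Gamma> n G \<one> x" by (auto simp: gamma_class_def)
  show "inv x \<in> gamma_class m \<Gamma> n G \<one>"
    using gamma_equiv_sym[OF gamma_equiv_mult_right[OF xG(2), of "inv x"]] xG(1)
    by (simp add: gamma_class_def)
  fix y assume y: "y \<in> gamma_class m \<Gamma> n G \<one>"
  hence yG: "y \<in> carrier G" "gamma_equiv m \<Gamma> n G \<one> y" by (auto simp: gamma_class_def)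
  show "x \<otimes> y \<in> gamma_class m \<Gamma> n G \<one>"
    using gamma_equiv_trans[OF yG(2), of "x \<otimes> y"] gamma_equiv_mult_right[OF xG(2) yG(1)] xG(1) yG(1)
    by (simp add: gamma_class_def)
qed

text \<open>
  The steps of a chain \<open>g 0, g 1, \<dots>\<close> from the identity are \<open>g (Suc j) \<otimes> inv (g j)\<close>. Each one lies on
  the translate by \<open>inv (g j)\<close> of a rational image of the curve, and this translate contains the identity.
\<close>

lemma gamma_class_swept_out:
  assumes "h \<in> gamma_class m \<Gamma> n G \<one>"
  shows "\<exists>X. parametrized n X \<and> X \<subseteq> gamma_class m \<Gamma> n G \<one> \<and> \<one> \<in> X \<and> h \<in> X"
proof -
  let ?H = "gamma_class m \<Gamma> n G \<one>"
  note H = gamma_class_subgroup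
  obtain N g where g: "\<forall>j\<le>N. g j \<in> carrier G" "g 0 = \<one>" "g N = h"
    "\<forall>j<N. gamma_link m \<Gamma> n G (g j) (g (Suc j))"
    using assms unfolding gamma_class_def gamma_equiv_def by blast
  have "\<exists>X. parametrized n X \<and> X \<subseteq> ?H \<and> \<one> \<in> X \<and> g j \<in> X" if "j \<le> N" for j
    using that
  proof (induction j)
    case 0
    have "parametrized n {\<one>}" using carrier_subset by (intro parametrized_singleton) auto
    thus ?case using g(2) subgroup.one_closed[OF H] by (intro exI[of _ "{\<one>}"]) auto
  next
    case (Suc j)
    then obtain X where X: "parametrized n X" "X \<subseteq> ?H" "\<one> \<in> X" "g j \<in> X" by auto
    have gj: "g j \<in> ?H" "g j \<in> carrier G" "g (Suc j) \<in> carrier G" using X g(1) Suc.prems by auto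
    have XG: "X \<subseteq> carrier G" using X(2) subgroup.subset[OF H] by blast
    have "gamma_link m \<Gamma> n G (g j) (g (Suc j))" using g(4) Suc.prems by simp
    then obtain U f p q where f: "rational_map m \<Gamma> n (carrier G) U f"
      and p: "p \<in> U" "q \<in> U" "f p = g j" "f q = g (Suc j)"
      unfolding gamma_link_def by (elim exE conjE)
    have fG: "f u \<in> carrier G" if "u \<in> U" for u
      using f that unfolding rational_map_def morphism_def by (elim conjE) blast
    have fH: "f u \<in> ?H" if u: "u \<in> U" for u
    proof -
      have "gamma_link m \<Gamma> n G (g j) (f u)"
        unfolding gamma_link_def by (intro exI[of _ U] exI[of _ f] exI[of _ p] exI[of _ u] conjI f p u refl)
      hence "gamma_equiv m \<Gamma> n G (g j) (f u)" by (rule gamma_equiv_link[OF gj(2) fG[OF u]])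
      moreover have "gamma_equiv m \<Gamma> n G \<one> (g j)" using gj(1) by (simp add: gamma_class_def)
      ultimately show ?thesis using gamma_equiv_trans fG[OF u] unfolding gamma_class_def by blast
    qed
    let ?Y = "{y \<otimes> z |y z. y \<in> f ` U \<and> z \<in> {inv (g j)}}"
    let ?X = "{y \<otimes> x |y x. y \<in> ?Y \<and> x \<in> X}"
    have "parametrized n (f ` U)" by (rule parametrized_rational_image[OF \<Gamma> f carrier_subset])
    moreover have "parametrized n {inv (g j)}"
      using gj(2) carrier_subset by (intro parametrized_singleton) auto
    ultimately have "parametrized n ?Y" using fG gj(2) by (intro parametrized_mult) auto
    moreover have YH: "?Y \<subseteq> ?H"
      using fH gj(1) subgroup.m_closed[OF H] subgroup.m_inv_closed[OF H] by auto
    moreover from YH have YG: "?Y \<subseteq> carrier G" using subgroup.subset[OF H] by (rule order_trans)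
    ultimately have "parametrized n ?X" by (intro parametrized_mult[OF _ YG X(1) XG])
    moreover have "?X \<subseteq> ?H" using YH X(2) subgroup.m_closed[OF H] by blast
    moreover have "\<one> \<in> ?Y"
    proof -
      have "\<one> = f p \<otimes> inv (g j)" using p(3) gj(2) by simp
      thus ?thesis using p(1) by blast
    qed
    hence "\<one> \<otimes> \<one> \<in> ?X" using X(3) by blast
    moreover have "f q \<otimes> inv (g j) \<in> ?Y" using p(2) by blast
    hence "(f q \<otimes> inv (g j)) \<otimes> g j \<in> ?X" using X(4) by blast
    hence "g (Suc j) \<in> ?X" using gj p(4) by (simp add: m_assoc)
    ultimately show ?case by (intro exI[of _ ?X]) simp
  qed
  thus ?thesis using g(3) by blast
qed

end

end

theorem proposition3p3:
  fixes G :: "'k::alg_closed_field point monoid"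
    and \<Gamma> :: "'k point set"
    and n m :: nat
  assumes "uncountable (UNIV :: 'k set)"
    and "projective_algebraic_group n G"
    and "smooth_projective_curve m \<Gamma>"
  shows "\<exists>A0 (I :: nat set) x.
           abelian_subvariety n G A0 \<and> countable I \<and> x ` I \<subseteq> carrier G \<and>
           {g \<in> carrier G. gamma_quot m \<Gamma> n G g = gamma_quot m \<Gamma> n G \<one>\<^bsub>G\<^esub>} =
             (\<Union>i\<in>I. x i <#\<^bsub>G\<^esub> A0)"
proof -
  interpret projective_group G n
    using assms(2) unfolding projective_algebraic_group_def projective_group_def projective_group_axioms_def
    by blast
  have \<Gamma>: "proj_closed m \<Gamma>" "proj_irreducible m \<Gamma>"
    using assms(3) by (auto simp: smooth_projective_curve_def)
  let ?H = "gamma_class m \<Gamma> n G \<one>\<^bsub>G\<^esub>"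
  have H: "subgroup ?H G" by (rule gamma_class_subgroup[OF \<Gamma>])
  have HG: "?H \<subseteq> carrier G" by (rule subgroup.subset[OF H])
  have "proj_closed n ?H \<and> proj_irreducible n ?H"
    by (rule subgroup_swept_out_is_closed[OF H gamma_class_swept_out[OF \<Gamma>]])
  hence "abelian_subvariety n G ?H" using H by (simp add: abelian_subvariety_def)
  moreover have "{g \<in> carrier G. gamma_quot m \<Gamma> n G g = gamma_quot m \<Gamma> n G \<one>\<^bsub>G\<^esub>} = ?H"
  proof -
    have "?H #>\<^bsub>G\<^esub> \<one>\<^bsub>G\<^esub> = ?H" using HG by (rule coset_mult_one)
    moreover have "?H #>\<^bsub>G\<^esub> g = ?H \<longleftrightarrow> g \<in> ?H" if "g \<in> carrier G" for g
      using coset_join1[OF _ that H] coset_join2[OF that H] by blast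
    ultimately show ?thesis using HG by (auto simp: gamma_quot_def)
  qed
  moreover have "\<one>\<^bsub>G\<^esub> <#\<^bsub>G\<^esub> ?H = ?H" using HG by (rule lcos_mult_one)
  ultimately show ?thesis
    by (intro exI[of _ ?H] exI[of _ "{0}"] exI[of _ "\<lambda>_. \<one>\<^bsub>G\<^esub>"]) simp
qed

end
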